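(* There is a (sufficiently large) positive integer $N$ such that the following holds. For every $A>0$ there is a constant $C>0$, depending only on $A$, such that for every bounded function $m$ on $\mathbb{R}^2$ that is smooth on $\mathbb{R}^2\setminus\{(0,0)\}$ and satisfies $$|\partial^\alpha m(\xi,\eta)|\le A\,(|\xi|+|\eta|)^{-|\alpha|}\qquad\text{for all } (\xi,\eta)\neq (0,0)$$ for all multi-indices $\alpha$ with $|\alpha|\le N$, and for all Schwartz functions $F_1,F_2,F_3,F_4\in\mathcal{S}(\mathbb{R}^2)$, the quadrilinear form $\Lambda=\Lambda_m$ satisfies $$|\Lambda(F_1,F_2,F_3,F_4)|\le C\,\|F_1\|_{\mathrm{L}^4(\mathbb{R}^2)}\|F_2\|_{\mathrm{L}^4(\mathbb{R}^2)}\|F_3\|_{\mathrm{L}^4(\mathbb{R}^2)}\|F_4\|_{\mathrm{L}^4(\mathbb{R}^2)}.$$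
   Context: The Fourier transform on $\mathbb{R}^n$ is $\widehat f(\omega):=\int_{\mathbb{R}^n} f(\tau)e^{-2\pi i\tau\cdot\omega}\,d\tau$. For four functions $F_1,F_2,F_3,F_4$ on $\mathbb{R}^2$, the entangled product is the function on $\mathbb{R}^4$ given by $$\boldsymbol{F}(x,x',y,y')=\boldsymbol{F}_{(F_1,F_2,F_3,F_4)}(x,x',y,y'):=F_1(x,y)F_2(x',y)F_3(x',y')F_4(x,y').$$ For $m$ as in the claim and Schwartz functions $F_j\in\mathcal{S}(\mathbb{R}^2)$, the quadrilinear form $\Lambda=\Lambda_m$ is defined by $$\Lambda(F_1,F_2,F_3,F_4):=\int_{\mathbb{R}^2}\widehat{\boldsymbol{F}}(\xi,-\xi,\eta,-\eta)\,m(\xi,\eta)\,d\xi\,d\eta .$$ *)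

theory Defs
  imports "HOL-Analysis.Analysis"
begin

definition partial_deriv ::
    "'a::euclidean_space \<Rightarrow> ('a \<Rightarrow> 'b::real_normed_vector) \<Rightarrow> 'a \<Rightarrow> 'b" where
  "partial_deriv b f x = vector_derivative (\<lambda>t. f (x + t *\<^sub>R b)) (at 0)"

text \<open>The list holds the coordinate directions; the last one is differentiated first.\<close>

definition iterated_partial ::
    "'a::euclidean_space list \<Rightarrow> ('a \<Rightarrow> 'b::real_normed_vector) \<Rightarrow> 'a \<Rightarrow> 'b" where
  "iterated_partial bs f = foldr partial_deriv bs f"

text \<open>Meant for open \<open>S\<close>. Differentiability (in the Frechet sense) of every iterated partial
  derivative makes all of them exist and be continuous on \<open>S\<close>, so this is the usual
  class of infinitely differentiable functions on \<open>S\<close>.\<close>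

definition smooth_on :: "'a::euclidean_space set \<Rightarrow> ('a \<Rightarrow> 'b::real_normed_vector) \<Rightarrow> bool" where
  "smooth_on S f \<longleftrightarrow> (\<forall>bs. set bs \<subseteq> Basis \<longrightarrow> iterated_partial bs f differentiable_on S)"

definition schwartz :: "('a::euclidean_space \<Rightarrow> complex) \<Rightarrow> bool" where
  "schwartz f \<longleftrightarrow> smooth_on UNIV f \<and>
     (\<forall>bs k. set bs \<subseteq> Basis \<longrightarrow>
        bounded (range (\<lambda>x. norm x ^ k *\<^sub>R iterated_partial bs f x)))"

text \<open>The derivative on the plane for the multi-index \<open>(a, b)\<close>.\<close>

definition multi_partial ::
    "nat \<Rightarrow> nat \<Rightarrow> (real \<times> real \<Rightarrow> complex) \<Rightarrow> real \<times> real \<Rightarrow> complex" where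
  "multi_partial a b f = iterated_partial (replicate a (1, 0) @ replicate b (0, 1)) f"

definition fourier_transform :: "('a::euclidean_space \<Rightarrow> complex) \<Rightarrow> 'a \<Rightarrow> complex" where
  "fourier_transform f \<omega> =
     (LINT \<tau>|lborel. f \<tau> * exp (- 2 * of_real pi * \<i> * of_real (\<tau> \<bullet> \<omega>)))"

definition Lp_norm :: "real \<Rightarrow> ('a::euclidean_space \<Rightarrow> complex) \<Rightarrow> real" where
  "Lp_norm p f = (LINT x|lborel. norm (f x) powr p) powr (1 / p)"

definition entangled_product ::
    "(real \<times> real \<Rightarrow> complex) \<Rightarrow> (real \<times> real \<Rightarrow> complex) \<Rightarrow>
     (real \<times> real \<Rightarrow> complex) \<Rightarrow> (real \<times> real \<Rightarrow> complex) \<Rightarrow>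
     real \<times> real \<times> real \<times> real \<Rightarrow> complex" where
  "entangled_product F1 F2 F3 F4 =
     (\<lambda>(x, x', y, y'). F1 (x, y) * F2 (x', y) * F3 (x', y') * F4 (x, y'))"

definition entangled_form ::
    "(real \<times> real \<Rightarrow> complex) \<Rightarrow>
     (real \<times> real \<Rightarrow> complex) \<Rightarrow> (real \<times> real \<Rightarrow> complex) \<Rightarrow>
     (real \<times> real \<Rightarrow> complex) \<Rightarrow> (real \<times> real \<Rightarrow> complex) \<Rightarrow> complex" where
  "entangled_form m F1 F2 F3 F4 =
     (LINT (\<xi>, \<eta>)|lborel.
        fourier_transform (entangled_product F1 F2 F3 F4) (\<xi>, - \<xi>, \<eta>, - \<eta>) * m (\<xi>, \<eta>))"

end

theory Submission
  imports Defs "HOL-Probability.Sinc_Integral" "HOL-Real_Asymp.Real_Asymp"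
begin

text \<open>
Let \<open>\<Phi> (\<xi>, \<eta>)\<close> (\<open>diag_ft\<close>) be the Fourier transform of the entangled product at
\<open>(\<xi>, - \<xi>, \<eta>, - \<eta>)\<close>, so that the form is \<open>\<integral> \<Phi> m\<close>. Doing the integrals over \<open>x\<close> and
\<open>x'\<close> first, for fixed \<open>y, y'\<close>, factorises it (\<open>diag_ft_slice\<close>):
\<open>\<Phi> (\<xi>, \<eta>) = \<integral> u(\<xi>; y, y') cnj (w(\<xi>; y, y')) e^{-2 \<pi> i (y - y') \<eta>} dy dy'\<close>, where
\<open>u\<close> is the Fourier transform in \<open>x\<close> of \<open>F1(x,y) F4(x,y')\<close> and \<open>w\<close> the one of
\<open>cnj (F2(x,y) F3(x,y'))\<close>. A multiplier \<open>c(t, \<xi>, \<eta>)\<close> therefore acts on \<open>u\<close> and \<open>w\<close> only through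
its Fourier transform in \<open>\<eta>\<close>, evaluated at \<open>y - y'\<close> (\<open>diag_form_eq_slice_form\<close>), while
\<open>\<xi>\<close> remains a frequency variable throughout.

The model multiplier is \<open>|\<xi>| e^{-t|\<xi>|} e^{-t|\<eta>|}\<close>. Its Fourier transform in \<open>\<eta>\<close> is
\<open>\<omega> = |\<xi>| e^{-t|\<xi>|} P_t(y - y')\<close> with the positive Poisson kernel \<open>P_t\<close>. Hence the model form is
bounded by the square functions \<open>Q(F, G) = \<integral> \<omega> |u|^2\<close> via Cauchy-Schwarz, and
\<open>(F, cnj F, cnj G, G)\<close> returns exactly \<open>Q(F, G) \<ge> 0\<close>. Now
\<open>- d/dt e^{-t(|\<xi>|+|\<eta>|)} = (|\<xi>| + |\<eta>|) e^{-t(|\<xi>|+|\<eta>|)}\<close>, so the model form plus its mirror image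
(coordinates exchanged) telescopes to the difference of two averages against a probability kernel
(\<open>poisson_form_telescope\<close>), and such averages are at most \<open>\<Prod> \<parallel>F_j\<parallel>_4\<close> by Hoelder
(\<open>poisson_mean_bound\<close>). For \<open>(F, cnj F, F, cnj F)\<close> both terms of the sum are squares, so each of them
is bounded by \<open>2 \<parallel>F\<parallel>_4^4\<close>. For \<open>(F, cnj F, cnj G, G)\<close> only the first term is a square,
but Cauchy-Schwarz bounds the second one by the case just treated; this gives
\<open>Q(F, G) \<le> 4 \<parallel>F\<parallel>_4^2 \<parallel>G\<parallel>_4^2\<close> (\<open>square_form_bound\<close>).

For general \<open>m\<close> use \<open>1 = \<integral>\<^sub>0\<^sup>\<infinity> 2 t (\<xi>^2 + \<eta>^2) e^{-t^2(\<xi>^2 + \<eta>^2)} dt\<close>. It suffices to treat the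
part of \<open>m\<close> carrying the factor \<open>\<xi>^2\<close>, the other one being its mirror image. For \<open>\<xi> \<noteq> 0\<close> the
function \<open>\<eta> \<mapsto> m(\<xi>, \<eta>)\<close> is smooth on the whole line, and two integrations by parts in \<open>\<eta>\<close>
show that the Fourier transform in \<open>\<eta>\<close> of this part is at most \<open>42 \<pi> A \<omega>\<close>
(\<open>partial_ft_gauss_symbol_bound\<close>). The second derivative costs
\<open>\<integral> d\<eta> / (\<xi>^2 + \<eta>^2) = \<pi> / |\<xi>|\<close>, which is why \<open>\<omega>\<close> carries \<open>|\<xi>|\<close> and not \<open>\<xi>^2\<close>, and why
two derivatives of \<open>m\<close>, that is \<open>N = 2\<close>, are enough.

All \<open>t\<close>-integrals run over \<open>[e, R]\<close> with \<open>0 < e \<le> R\<close>; the bounds do not depend on \<open>e\<close> and \<open>R\<close>,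
and dominated convergence removes the truncation at the very end (\<open>entangled_form_bound\<close>).
\<close>

section \<open>Integration on product spaces\<close>

lemma lborel_iterated_integrals:
  fixes f :: "'a::euclidean_space \<times> 'b::euclidean_space \<Rightarrow> 'c::{banach, second_countable_topology}"
  assumes "integrable lborel f"
  shows lborel_integral_fst: "(LINT x|lborel. LINT y|lborel. f (x, y)) = integral\<^sup>L lborel f"
    and lborel_integral_snd: "(LINT y|lborel. LINT x|lborel. f (x, y)) = integral\<^sup>L lborel f"
    and lborel_integrable_fst: "integrable lborel (\<lambda>x. LINT y|lborel. f (x, y))"
    and lborel_integrable_snd: "integrable lborel (\<lambda>y. LINT x|lborel. f (x, y))"
    and lborel_AE_integrable_fst: "AE x in lborel. integrable lborel (\<lambda>y. f (x, y))"
proof -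
  have f: "integrable (lborel \<Otimes>\<^sub>M lborel) (case_prod (\<lambda>x y. f (x, y)))"
    using assms by (simp add: lborel_prod)
  show "(LINT x|lborel. LINT y|lborel. f (x, y)) = integral\<^sup>L lborel f"
    using lborel_pair.integral_fst[OF f] by (simp add: lborel_prod)
  show "(LINT y|lborel. LINT x|lborel. f (x, y)) = integral\<^sup>L lborel f"
    using lborel_pair.integral_snd[OF f] by (simp add: lborel_prod)
  show "integrable lborel (\<lambda>x. LINT y|lborel. f (x, y))" "integrable lborel (\<lambda>y. LINT x|lborel. f (x, y))"
    "AE x in lborel. integrable lborel (\<lambda>y. f (x, y))"
    using lborel_pair.integrable_fst[OF f] lborel_pair.integrable_snd[OF f] lborel_pair.AE_integrable_fst[OF f]
    by auto
qed

text \<open>All integrands below are dominated by such products in separated variables, so this lemma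
supplies nearly every integrability claim.\<close>

lemma integrable_tensor:
  fixes f :: "'a::euclidean_space \<Rightarrow> 'c::{real_normed_field, banach, second_countable_topology}"
    and g :: "'b::euclidean_space \<Rightarrow> 'c"
  assumes [simp]: "integrable lborel f" "integrable lborel g"
  shows "integrable lborel (\<lambda>p. f (fst p) * g (snd p))"
proof -
  have [measurable]: "f \<in> borel_measurable borel" "g \<in> borel_measurable borel"
    using assms[THEN borel_measurable_integrable] by auto
  have "integrable (lborel \<Otimes>\<^sub>M lborel) (\<lambda>p. f (fst p) * g (snd p))"
    by (rule lborel_pair.Fubini_integrable) (auto simp: norm_mult)
  then show ?thesis by (simp add: lborel_prod)
qed

lemma integral_tensor:
  fixes f :: "'a::euclidean_space \<Rightarrow> 'c::{real_normed_field, banach, second_countable_topology}"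
    and g :: "'b::euclidean_space \<Rightarrow> 'c"
  assumes "integrable lborel f" "integrable lborel g"
  shows "(LINT p|lborel. f (fst p) * g (snd p)) = (LINT x|lborel. f x) * (LINT y|lborel. g y)"
  using lborel_integral_fst[OF integrable_tensor[OF assms]] by simp

lemma lborel_integral_swap:
  fixes f :: "'a::euclidean_space \<times> 'b::euclidean_space \<Rightarrow> 'c::{banach, second_countable_topology}"
  assumes "f \<in> borel_measurable borel"
  shows "(LINT p|lborel. f (snd p, fst p)) = integral\<^sup>L lborel f"
proof -
  have "f \<in> borel_measurable (lborel \<Otimes>\<^sub>M lborel)" using assms by (simp add: lborel_prod)
  from lborel_pair.integral_product_swap[OF this] show ?thesis
    by (simp add: lborel_prod case_prod_beta')
qed

lemma integrable_lborel_swap: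
  fixes f :: "'a::euclidean_space \<times> 'b::euclidean_space \<Rightarrow> 'c::{banach, second_countable_topology}"
  assumes "integrable lborel f"
  shows "integrable lborel (\<lambda>p. f (snd p, fst p))"
  using lborel_pair.integrable_product_swap[of f] assms
  by (simp add: lborel_prod case_prod_beta')

section \<open>Decaying weights, Fourier integrals and the Poisson kernel\<close>

definition decay :: "real \<Rightarrow> real" where "decay x = inverse (1 + x\<^sup>2)"

lemma decay_pos: "decay x > 0" and decay_le_1: "decay x \<le> 1"
  by (auto simp: decay_def add_pos_nonneg field_simps)

lemma decay_nonneg[simp]: "0 \<le> decay x" using decay_pos[of x] by simp

lemma borel_measurable_decay[measurable]: "decay \<in> borel_measurable borel"
  unfolding decay_def[abs_def] by measurable

lemma integrable_decay: "integrable lborel decay"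
  using integrable_inverse_1_plus_square by (simp add: set_integrable_def decay_def[abs_def])

lemma integral_decay: "(LINT x|lborel. decay x) = pi"
  using LBINT_inverse_1_plus_square
  by (simp add: interval_lebesgue_integral_def set_lebesgue_integral_def decay_def[abs_def])

lemma decay_scaled:
  assumes "c > 0"
  shows integrable_decay_scaled: "integrable lborel (\<lambda>x. decay (c * x))"
    and integral_decay_scaled: "(LINT x|lborel. decay (c * x)) = pi / c"
proof -
  show "integrable lborel (\<lambda>x. decay (c * x))"
    using lborel_integrable_real_affine_iff[of c decay 0] assms integrable_decay by simp
  show "(LINT x|lborel. decay (c * x)) = pi / c"
    using lborel_integral_real_affine[of c decay 0] assms integral_decay by (simp add: field_simps)
qed

text \<open>Integration by parts on the line in the form needed later: an integrable total derivative of a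
function vanishing at both ends has integral zero.\<close>

lemma integral_derivative_real_line:
  fixes F f :: "real \<Rightarrow> complex"
  assumes "\<And>x. (F has_vector_derivative f x) (at x)" "continuous_on UNIV f" "integrable lborel f"
    and "(F \<longlongrightarrow> 0) at_top" "(F \<longlongrightarrow> 0) at_bot"
  shows "(LINT x|lborel. f x) = 0"
proof -
  have "(LBINT x=-\<infinity>..\<infinity>. f x) = 0 - 0"
  proof (rule interval_integral_FTC_integrable[of _ _ F])
    show "\<And>x. isCont f x" using assms(2) by (simp add: continuous_on_eq_continuous_at)
    show "set_integrable lborel (einterval (- \<infinity>) \<infinity>) f" using assms(3) by (simp add: set_integrable_def)
  qed (use assms in \<open>auto simp: ereal_tendsto_simps\<close>)
  then show ?thesis by (simp add: interval_lebesgue_integral_def set_lebesgue_integral_def)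
qed

text \<open>The character of the Fourier transform in dimension one, \<open>e^{-2 \<pi> i s}\<close>.\<close>

definition wave :: "real \<Rightarrow> complex" where "wave s = cis (- (2 * pi * s))"

lemma norm_wave[simp]: "norm (wave s) = 1" by (simp add: wave_def)
lemma wave_add: "wave (a + b) = wave a * wave b" by (simp add: wave_def cis_mult algebra_simps)
lemma wave_minus: "wave (- a) = cnj (wave a)" by (simp add: wave_def cis_cnj)
lemma borel_measurable_wave[measurable]: "wave \<in> borel_measurable borel"
  unfolding wave_def[abs_def] cis_conv_exp by measurable

lemma exp_eq_wave: "exp (- 2 * of_real pi * \<i> * of_real s) = wave s"
  by (simp add: wave_def cis_conv_exp algebra_simps)

text \<open>The Poisson kernel of the half plane at height \<open>t / (2 \<pi>)\<close>: the normalisation makes it the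
Fourier transform of \<open>e^{-t|\<eta>|}\<close>, and it is a probability density in \<open>v\<close>.\<close>

definition poisson :: "real \<Rightarrow> real \<Rightarrow> real" where
  "poisson t v = 2 * t / (t\<^sup>2 + (2 * pi * v)\<^sup>2)"

lemma poisson_eq_decay: "t > 0 \<Longrightarrow> poisson t v = 2 / t * decay (2 * pi / t * v)"
  by (simp add: poisson_def decay_def divide_simps) (simp add: algebra_simps power2_eq_square)

lemma poisson_nonneg: "t > 0 \<Longrightarrow> poisson t v \<ge> 0" by (simp add: poisson_def)
lemma integral_poisson: "t > 0 \<Longrightarrow> (LINT v|lborel. poisson t v) = 1"
  and integrable_poisson: "t > 0 \<Longrightarrow> integrable lborel (poisson t)"
  using integrable_decay_scaled[of "2 * pi / t"] integral_decay_scaled[of "2 * pi / t"]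
  by (simp_all add: poisson_eq_decay cong: Bochner_Integration.integral_cong Bochner_Integration.integrable_cong)

text \<open>From \<open>z \<le> e^z\<close> at \<open>z = e (1 + x) / 4\<close>, raised to the fourth power.\<close>

lemma fourth_power_exp_bound:
  fixes e x :: real
  assumes "e > 0" "x \<ge> 0"
  shows "(1 + x) ^ 4 * exp (- (e * x)) \<le> (4 / e) ^ 4 * exp e"
proof -
  have "e * (1 + x) / 4 \<le> exp (e * (1 + x) / 4)" using exp_ge_add_one_self[of "e * (1 + x) / 4"] by linarith
  then have "(e * (1 + x) / 4) ^ 4 \<le> exp (e * (1 + x) / 4) ^ 4" using assms by (intro power_mono) auto
  also have "\<dots> = exp (e * (1 + x))" by (simp add: exp_of_nat_mult[symmetric])
  also have "\<dots> = exp e * exp (e * x)" by (simp add: exp_add[symmetric] algebra_simps)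
  finally have "(1 + x) ^ 4 * exp (- (e * x)) \<le> (4 / e) ^ 4 * (exp e * exp (e * x)) * exp (- (e * x))"
    using assms by (intro mult_right_mono) (auto simp: field_simps simp flip: power_mult_distrib)
  also have "\<dots> = (4 / e) ^ 4 * exp e" by (simp add: exp_minus field_simps)
  finally show ?thesis .
qed

lemma exp_le_decay:
  fixes e :: real
  assumes "e > 0"
  obtains D where "D > 0"
    "\<And>x. (1 + \<bar>x\<bar> + x\<^sup>2) * exp (- (e * \<bar>x\<bar>)) \<le> D * decay x"
proof
  show "(4 / e) ^ 4 * exp e > 0" using assms by simp
  fix x :: real
  have "(1 + \<bar>x\<bar> + x\<^sup>2) * (1 + x\<^sup>2) \<le> (1 + \<bar>x\<bar>) ^ 2 * (1 + \<bar>x\<bar>) ^ 2"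
    by (intro mult_mono) (auto simp: power2_eq_square algebra_simps)
  also have "\<dots> = (1 + \<bar>x\<bar>) ^ 4" by (simp flip: power_add)
  finally have "(1 + \<bar>x\<bar> + x\<^sup>2) * (1 + x\<^sup>2) * exp (- (e * \<bar>x\<bar>)) \<le> (1 + \<bar>x\<bar>) ^ 4 * exp (- (e * \<bar>x\<bar>))"
    by (intro mult_right_mono) auto
  also have "\<dots> \<le> (4 / e) ^ 4 * exp e" by (rule fourth_power_exp_bound) (use assms in auto)
  finally show "(1 + \<bar>x\<bar> + x\<^sup>2) * exp (- (e * \<bar>x\<bar>)) \<le> (4 / e) ^ 4 * exp e * decay x"
    using decay_pos[of x] by (simp add: decay_def add_pos_nonneg flip: divide_inverse)
      (subst pos_le_divide_eq, simp_all add: add_pos_nonneg mult_ac)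
qed

text \<open>Reduces to the exponential weight: \<open>(e |x| - 1/2)^2 \<ge> 0\<close> gives
\<open>e^2 x^2 \<ge> e |x| - 1\<close>.\<close>

lemma gauss_le_decay:
  fixes e :: real
  assumes "e > 0"
  obtains D where "D > 0"
    "\<And>x. (1 + \<bar>x\<bar> + x\<^sup>2) * exp (- (e\<^sup>2 * x\<^sup>2)) \<le> D * decay x"
proof -
  obtain D where D: "D > 0" "\<And>x. (1 + \<bar>x\<bar> + x\<^sup>2) * exp (- (e * \<bar>x\<bar>)) \<le> D * decay x"
    using exp_le_decay[OF assms] by blast
  show thesis
  proof
    show "exp 1 * D > 0" using D by simp
    fix x :: real
    have "0 \<le> (e * \<bar>x\<bar> - 1/2)\<^sup>2" by simp
    also have "\<dots> = e\<^sup>2 * x\<^sup>2 - e * \<bar>x\<bar> + 1/4" by (simp add: power2_diff power_mult_distrib power_divide)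
    finally have "- (e\<^sup>2 * x\<^sup>2) \<le> 1 + - (e * \<bar>x\<bar>)" by linarith
    then have "exp (- (e\<^sup>2 * x\<^sup>2)) \<le> exp (1 + - (e * \<bar>x\<bar>))" by simp
    also have "\<dots> = exp 1 * exp (- (e * \<bar>x\<bar>))" by (rule exp_add)
    finally have "(1 + \<bar>x\<bar> + x\<^sup>2) * exp (- (e\<^sup>2 * x\<^sup>2)) \<le> (1 + \<bar>x\<bar> + x\<^sup>2) * (exp 1 * exp (- (e * \<bar>x\<bar>)))"
      by (intro mult_left_mono) auto
    also have "\<dots> = exp 1 * ((1 + \<bar>x\<bar> + x\<^sup>2) * exp (- (e * \<bar>x\<bar>)))" by simp
    also have "\<dots> \<le> exp 1 * (D * decay x)" by (intro mult_left_mono D) auto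
    finally show "(1 + \<bar>x\<bar> + x\<^sup>2) * exp (- (e\<^sup>2 * x\<^sup>2)) \<le> exp 1 * D * decay x" by simp
  qed
qed

lemma integrable_le_decay:
  fixes f :: "real \<Rightarrow> 'a::{banach, second_countable_topology}"
  assumes "f \<in> borel_measurable borel" "\<And>x. norm (f x) \<le> D * decay x"
  shows "integrable lborel f"
proof (rule Bochner_Integration.integrable_bound)
  show "integrable lborel (\<lambda>x. D * decay x)" using integrable_decay by simp
  show "AE x in lborel. norm (f x) \<le> norm (D * decay x)" using assms(2) by (auto intro: order_trans[OF _ abs_ge_self])
qed (use assms in auto)

lemma integrable_exp_abs: "(t::real) > 0 \<Longrightarrow> integrable lborel (\<lambda>x. exp (- (t * \<bar>x\<bar>)))"
proof -
  assume "t > 0"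
  then obtain D where D: "\<And>x. (1 + \<bar>x\<bar> + x\<^sup>2) * exp (- (t * \<bar>x\<bar>)) \<le> D * decay x" using exp_le_decay by metis
  have "1 * exp (- (t * \<bar>x\<bar>)) \<le> (1 + \<bar>x\<bar> + x\<^sup>2) * exp (- (t * \<bar>x\<bar>))" for x :: real by (intro mult_right_mono) auto
  then have "exp (- (t * \<bar>x\<bar>)) \<le> D * decay x" for x using D[of x] by (metis mult_1 order_trans)
  then show ?thesis by (intro integrable_le_decay[where D = D]) auto
qed

text \<open>The two half lines contribute \<open>1 / (t + 2 \<pi> i v)\<close> and its conjugate.\<close>

lemma fourier_exp_abs:
  assumes t: "t > 0"
  shows "(LINT x|lborel. complex_of_real (exp (- (t * \<bar>x\<bar>))) * wave (v * x)) = poisson t v"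
proof -
  define f where "f = (\<lambda>x::real. complex_of_real (exp (- (t * \<bar>x\<bar>))) * wave (v * x))"
  have [measurable]: "f \<in> borel_measurable borel" unfolding f_def by measurable
  have f: "integrable lborel f"
    by (rule Bochner_Integration.integrable_bound[OF integrable_exp_abs[OF t]]) (auto simp: f_def norm_mult)
  have half: "(LBINT x=0..\<infinity>. complex_of_real (exp (- (t * \<bar>x\<bar>))) * wave (w * x)) = 1 / (t + 2 * pi * w * \<i>)" for w
  proof -
    define z where "z = - (complex_of_real t + 2 * pi * w * \<i>)"
    have z: "z \<noteq> 0" "Re z = - t" using t by (auto simp: z_def complex_eq_iff)
    have eq: "complex_of_real (exp (- (t * \<bar>x\<bar>))) * wave (w * x) = exp (z * x)" if "x \<ge> 0" for x
      using that by (simp add: wave_def cis_conv_exp z_def exp_of_real[symmetric] exp_add[symmetric] algebra_simps)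
    have g: "integrable lborel (\<lambda>x. complex_of_real (exp (- (t * \<bar>x\<bar>))) * wave (w * x))"
      by (rule Bochner_Integration.integrable_bound[OF integrable_exp_abs[OF t]]) (auto simp: norm_mult)
    have "(LBINT x=0..\<infinity>. complex_of_real (exp (- (t * \<bar>x\<bar>))) * wave (w * x)) = (LBINT x=0..\<infinity>. exp (z * x))"
      by (rule interval_integral_cong, rule eq) (auto simp: einterval_iff)
    also have "\<dots> = 0 - 1 / z"
    proof (rule interval_integral_FTC_integrable[where F = "\<lambda>x. exp (z * x) / z"])
      show "((\<lambda>x. exp (z * complex_of_real x) / z) has_vector_derivative exp (z * x)) (at x)" for x
        using z by (auto intro!: derivative_eq_intros has_vector_derivative_real_field)
      have "set_integrable lborel (einterval 0 \<infinity>) (\<lambda>x. complex_of_real (exp (- (t * \<bar>x\<bar>))) * wave (w * x))"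
        using integrable_mult_indicator[OF _ g, of "einterval 0 \<infinity>"] by (simp add: set_integrable_def)
      moreover have "complex_of_real (exp (- (t * \<bar>x\<bar>))) * wave (w * x) = exp (z * x)" if "x \<in> einterval 0 \<infinity>" for x
        by (rule eq) (use that in \<open>auto simp: einterval_iff\<close>)
      ultimately show "set_integrable lborel (einterval 0 \<infinity>) (\<lambda>x. exp (z * complex_of_real x))"
        by (rule iffD1[OF set_integrable_cong[OF refl refl], rotated]) simp
      have "((\<lambda>x. norm (exp (z * complex_of_real x) / z)) \<longlongrightarrow> 0) at_top"
        using t by (simp add: norm_divide z) (intro tendsto_divide_zero; real_asymp)
      then show "(((\<lambda>x. exp (z * complex_of_real x) / z) \<circ> real_of_ereal) \<longlongrightarrow> 0) (at_left \<infinity>)"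
        by (auto simp: ereal_tendsto_simps tendsto_norm_zero_iff)
      have "((\<lambda>x. exp (z * complex_of_real x) / z) \<longlongrightarrow> exp (z * complex_of_real 0) / z) (at_right 0)"
        using z by (intro tendsto_intros) auto
      then show "(((\<lambda>x. exp (z * complex_of_real x) / z) \<circ> real_of_ereal) \<longlongrightarrow> 1 / z) (at_right 0)"
        by (simp add: zero_ereal_def ereal_tendsto_simps)
    qed (auto simp: intro!: continuous_intros)
    also have "\<dots> = 1 / (t + 2 * pi * w * \<i>)" by (simp only: z_def diff_0 minus_divide_right minus_minus)
    finally show ?thesis .
  qed
  have "(LINT x|lborel. f x) = (LBINT x=-\<infinity>..\<infinity>. f x)"
    by (simp add: interval_lebesgue_integral_def set_lebesgue_integral_def)
  also have "\<dots> = (LBINT x=-\<infinity>..0. f x) + (LBINT x=0..\<infinity>. f x)"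
    by (rule interval_integral_sum[symmetric]) (use f in \<open>auto simp: interval_lebesgue_integrable_def set_integrable_def min_def max_def\<close>)
  also have "(LBINT x=-\<infinity>..0. f x) = (LBINT x=0..\<infinity>. f (- x))"
    by (subst interval_integral_reflect) simp
  also have "\<dots> = 1 / (t + 2 * pi * (- v) * \<i>)" using half[of "- v"] by (simp add: f_def)
  also have "(LBINT x=0..\<infinity>. f x) = 1 / (t + 2 * pi * v * \<i>)" using half[of v] by (simp add: f_def)
  also have "1 / (t + 2 * pi * (- v) * \<i>) + 1 / (t + 2 * pi * v * \<i>) = poisson t v"
  proof -
    have n: "t + 2 * pi * v * \<i> \<noteq> 0" "t + 2 * pi * (- v) * \<i> \<noteq> 0" using t by (auto simp: complex_eq_iff)
    have "complex_of_real (t\<^sup>2 + (2 * pi * v)\<^sup>2) = (t + 2 * pi * v * \<i>) * (t + 2 * pi * (- v) * \<i>)"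
      by (simp add: algebra_simps power2_eq_square)
    then show ?thesis using n unfolding poisson_def of_real_divide by (simp add: divide_simps)
  qed
  finally show ?thesis by (simp add: f_def)
qed

section \<open>The diagonal Fourier transform\<close>

lemma borel_measurable_fst_snd[measurable]:
  "(fst :: 'a::second_countable_topology \<times> 'b::second_countable_topology \<Rightarrow> 'a) \<in> borel_measurable borel"
  "(snd :: 'a::second_countable_topology \<times> 'b::second_countable_topology \<Rightarrow> 'b) \<in> borel_measurable borel"
  by (rule borel_measurable_continuous_onI[OF continuous_on_fst[OF continuous_on_id]],
      rule borel_measurable_continuous_onI[OF continuous_on_snd[OF continuous_on_id]])

lemma emeasure_lborel_Times:
  assumes "A \<in> sets borel" "B \<in> sets borel"
  shows "emeasure lborel ((A :: 'a::euclidean_space set) \<times> (B :: 'b::euclidean_space set))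
    = emeasure lborel A * emeasure lborel B"
  using assms by (subst lborel_prod[symmetric], subst lborel.emeasure_pair_measure_Times) auto

lemma box_Times_sets: "box a b \<times> box c d \<in> sets borel"
  for a b :: "'a::euclidean_space" and c d :: "'b::euclidean_space"
  using borel_open[OF open_box, of "(a, c)" "(b, d)"] by (simp add: box_prod)

text \<open>The type of the entangled product nests its variables as \<open>(x, (x', (y, y')))\<close>, while the proof
needs the pairs \<open>((x, x'), (y, y'))\<close>; the same regrouping is used for \<open>((t, \<xi>), \<eta>)\<close>.\<close>

lemma lborel_distr_assoc:
  "distr lborel borel (\<lambda>r. (fst (fst r), snd (fst r), snd r)) =
     (lborel :: ('a::euclidean_space \<times> 'b::euclidean_space \<times> 'c::euclidean_space) measure)"
proof (rule lborel_eqI[symmetric], clarify)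
  fix la ua :: 'a and lb ub :: 'b and lc uc :: 'c
  assume lu: "\<And>a b c. (a, b, c) \<in> Basis \<Longrightarrow> (la, lb, lc) \<bullet> (a, b, c) \<le> (ua, ub, uc) \<bullet> (a, b, c)"
  have m: "(\<lambda>r::('a \<times> 'b) \<times> 'c. (fst (fst r), snd (fst r), snd r)) \<in> lborel \<rightarrow>\<^sub>M borel" by measurable
  have b: "box (la, lb, lc) (ua, ub, uc) = box la ua \<times> box lb ub \<times> box lc uc"
    by (simp only: box_prod[of "(la, lb, lc)"] box_prod[of "(lb, lc)"] fst_conv snd_conv)
  have "emeasure (distr lborel borel (\<lambda>r. (fst (fst r), snd (fst r), snd r))) (box (la, lb, lc) (ua, ub, uc))
    = emeasure lborel ((\<lambda>r. (fst (fst r), snd (fst r), snd r)) -` box (la, lb, lc) (ua, ub, uc))"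
    using emeasure_distr[OF m borel_open[OF open_box], of "(la, lb, lc)" "(ua, ub, uc)"]
    by (simp only: space_lborel space_borel Int_UNIV_right)
  also have "(\<lambda>r. (fst (fst r), snd (fst r), snd r)) -` box (la, lb, lc) (ua, ub, uc) = (box la ua \<times> box lb ub) \<times> box lc uc"
    unfolding b by auto
  also have "emeasure lborel \<dots> = emeasure lborel (box (la, lb, lc) (ua, ub, uc))"
    using box_Times_sets[of lb ub lc uc] box_Times_sets[of la ua lb ub]
    by (simp only: b emeasure_lborel_Times borel_open open_box mult.assoc)
  also have "\<dots> = ennreal (prod ((\<bullet>) ((ua, ub, uc) - (la, lb, lc))) Basis)"
  proof (rule emeasure_lborel_box)
    fix w :: "'a \<times> 'b \<times> 'c" assume "w \<in> Basis"
    then show "(la, lb, lc) \<bullet> w \<le> (ua, ub, uc) \<bullet> w"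
      using lu[of "fst w" "fst (snd w)" "snd (snd w)"] by (simp only: prod.collapse)
  qed
  finally show "emeasure (distr lborel borel (\<lambda>r. (fst (fst r), snd (fst r), snd r))) (box (la, lb, lc) (ua, ub, uc))
    = ennreal (prod ((\<bullet>) ((ua, ub, uc) - (la, lb, lc))) Basis)" .
qed simp

lemma lborel_integral_assoc:
  fixes f :: "'a::euclidean_space \<times> 'b::euclidean_space \<times> 'c::euclidean_space \<Rightarrow> 'd::{banach, second_countable_topology}"
  assumes [measurable]: "f \<in> borel_measurable borel"
  shows "(LINT r|lborel. f (fst (fst r), snd (fst r), snd r)) = integral\<^sup>L lborel f"
    and "integrable lborel (\<lambda>r. f (fst (fst r), snd (fst r), snd r)) \<longleftrightarrow> integrable lborel f"
proof -
  have m: "(\<lambda>r::('a \<times> 'b) \<times> 'c. (fst (fst r), snd (fst r), snd r)) \<in> lborel \<rightarrow>\<^sub>M borel" by measurable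
  show "(LINT r|lborel. f (fst (fst r), snd (fst r), snd r)) = integral\<^sup>L lborel f"
    using integral_distr[OF m, of f] by (simp add: lborel_distr_assoc)
  show "integrable lborel (\<lambda>r. f (fst (fst r), snd (fst r), snd r)) \<longleftrightarrow> integrable lborel f"
    using integrable_distr_eq[OF m, of f] by (simp add: lborel_distr_assoc)
qed

text \<open>A class of functions containing the Schwartz functions and closed under conjugation and exchange of
the coordinates. The pointwise product decay makes the sliced integrals converge for every value
of the remaining variables, not only for almost every one.\<close>

definition admissible :: "(real \<times> real \<Rightarrow> complex) \<Rightarrow> bool" where
  "admissible F \<longleftrightarrow> F \<in> borel_measurable borel \<and>
     (\<exists>B. \<forall>x y. cmod (F (x, y)) \<le> B * (decay x * decay y))"

definition flip :: "(real \<times> real \<Rightarrow> complex) \<Rightarrow> real \<times> real \<Rightarrow> complex" where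
  "flip F p = F (snd p, fst p)"

definition conjg :: "(real \<times> real \<Rightarrow> complex) \<Rightarrow> real \<times> real \<Rightarrow> complex" where
  "conjg F p = cnj (F p)"

lemma conjg_conjg[simp]: "conjg (conjg F) = F" by (simp add: conjg_def fun_eq_iff)
lemma flip_conjg: "flip (conjg F) = conjg (flip F)" by (auto simp: flip_def conjg_def)

lemma admissible_measurable: "admissible F \<Longrightarrow> F \<in> borel_measurable borel"
  by (simp add: admissible_def)

lemma admissible_bound:
  assumes "admissible F"
  obtains B where "B \<ge> 0" "\<And>x y. cmod (F (x, y)) \<le> B * (decay x * decay y)"
proof -
  obtain B where B: "\<And>x y. cmod (F (x, y)) \<le> B * (decay x * decay y)" using assms by (auto simp: admissible_def)
  have "0 \<le> B * (decay 0 * decay 0)" using B[of 0 0] norm_ge_zero order_trans by blast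
  then have "B \<ge> 0" by (simp add: decay_def)
  with B that show thesis by blast
qed

lemma admissible_flip:
  assumes "admissible F"
  shows "admissible (flip F)"
proof -
  obtain B where B: "\<And>x y. cmod (F (x, y)) \<le> B * (decay x * decay y)" using admissible_bound assms by metis
  have [measurable]: "F \<in> borel_measurable borel" by (rule admissible_measurable[OF assms])
  have "cmod (flip F (x, y)) \<le> B * (decay x * decay y)" for x y
    using B[of y x] by (simp add: flip_def mult.commute)
  then show ?thesis unfolding admissible_def using measurable_compose[OF _ \<open>F \<in> borel_measurable borel\<close>, of "\<lambda>p. (snd p, fst p)" borel] by (auto simp: flip_def[abs_def])
qed

lemma borel_measurable_cnj[measurable]: "cnj \<in> borel_measurable borel"
  by (intro borel_measurable_continuous_onI continuous_intros)

lemma admissible_conjg: "admissible F \<Longrightarrow> admissible (conjg F)"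
  unfolding admissible_def conjg_def[abs_def] by (auto intro: measurable_compose[OF _ borel_measurable_cnj])

text \<open>The function \<open>u(\<xi>; y, y')\<close> of the introduction, with \<open>q = (y, y')\<close>; \<open>slice_prod\<close> is
\<open>u cnj w\<close>. The conjugate of \<open>w\<close> arises because \<open>x'\<close> is paired with the frequency \<open>- \<xi>\<close>.\<close>

definition slice_ft :: "(real \<times> real \<Rightarrow> complex) \<Rightarrow> (real \<times> real \<Rightarrow> complex) \<Rightarrow> real \<Rightarrow> real \<times> real \<Rightarrow> complex" where
  "slice_ft F G \<xi> q = (LINT x|lborel. F (x, fst q) * G (x, snd q) * wave (\<xi> * x))"

definition slice_prod where
  "slice_prod F1 F2 F3 F4 \<xi> q = slice_ft F1 F4 \<xi> q * cnj (slice_ft (conjg F2) (conjg F3) \<xi> q)"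

definition diag_ft where
  "diag_ft F1 F2 F3 F4 p =
     fourier_transform (entangled_product F1 F2 F3 F4) (fst p, - fst p, snd p, - snd p)"

lemma slice_integrand_integrable:
  assumes "admissible F" "admissible G"
  shows "integrable lborel (\<lambda>x. F (x, y) * G (x, y') * wave (\<xi> * x))"
proof -
  have [measurable]: "F \<in> borel_measurable borel" "G \<in> borel_measurable borel" using assms by (auto simp: admissible_def)
  obtain B where B: "B \<ge> 0" "\<And>x y. cmod (F (x, y)) \<le> B * (decay x * decay y)" using admissible_bound assms by metis
  obtain D where D: "D \<ge> 0" "\<And>x y. cmod (G (x, y)) \<le> D * (decay x * decay y)" using admissible_bound assms by metis
  show ?thesis
  proof (rule integrable_le_decay)
    fix x
    have "cmod (F (x, y)) * cmod (G (x, y')) \<le> (B * (decay x * 1)) * (D * (1 * 1))"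
      by (intro mult_mono order_trans[OF B(2)] order_trans[OF D(2)] B D decay_le_1 mult_nonneg_nonneg) auto
    then show "norm (F (x, y) * G (x, y') * wave (\<xi> * x)) \<le> (B * D) * decay x" by (simp add: norm_mult mult_ac)
  qed measurable
qed

lemma slice_ft_bound:
  assumes "admissible F" "admissible G"
  obtains C where "C \<ge> 0" "\<And>\<xi> q. cmod (slice_ft F G \<xi> q) \<le> C * (decay (fst q) * decay (snd q))"
proof -
  obtain B where B: "B \<ge> 0" "\<And>x y. cmod (F (x, y)) \<le> B * (decay x * decay y)" using admissible_bound assms by metis
  obtain D where D: "D \<ge> 0" "\<And>x y. cmod (G (x, y)) \<le> D * (decay x * decay y)" using admissible_bound assms by metis
  have "cmod (slice_ft F G \<xi> q) \<le> (B * D * pi) * (decay (fst q) * decay (snd q))" for \<xi> q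
  proof -
    have "cmod (slice_ft F G \<xi> q) \<le> (LINT x|lborel. norm (F (x, fst q) * G (x, snd q) * wave (\<xi> * x)))"
      unfolding slice_ft_def by (rule integral_norm_bound)
    also have "\<dots> \<le> (LINT x|lborel. (B * D * decay (fst q) * decay (snd q)) * decay x)"
    proof (rule integral_mono)
      show "integrable lborel (\<lambda>x. norm (F (x, fst q) * G (x, snd q) * wave (\<xi> * x)))"
        using slice_integrand_integrable[OF assms] by (rule integrable_norm)
      fix x
      have "cmod (F (x, fst q)) * cmod (G (x, snd q)) \<le> (B * (decay x * decay (fst q))) * (D * (1 * decay (snd q)))"
        by (intro mult_mono order_trans[OF B(2)] order_trans[OF D(2)] mult_left_mono B D decay_le_1 mult_nonneg_nonneg) auto
      then show "norm (F (x, fst q) * G (x, snd q) * wave (\<xi> * x)) \<le> (B * D * decay (fst q) * decay (snd q)) * decay x"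
        by (simp add: norm_mult mult_ac)
    qed (use integrable_decay in simp)
    also have "\<dots> = (B * D * pi) * (decay (fst q) * decay (snd q))" by (simp add: integral_decay)
    finally show ?thesis .
  qed
  then show thesis using that[of "B * D * pi"] B D by auto
qed

lemma slice_ft_measurable:
  assumes "admissible F" "admissible G"
  shows "(\<lambda>s. slice_ft F G (fst s) (snd s)) \<in> borel_measurable borel"
proof -
  have [measurable]: "F \<in> borel_measurable borel" "G \<in> borel_measurable borel" using assms by (auto simp: admissible_def)
  show ?thesis unfolding slice_ft_def by (rule lborel.borel_measurable_lebesgue_integral) measurable
qed

lemma slice_prod_measurable:
  assumes "admissible F1" "admissible F2" "admissible F3" "admissible F4"
  shows "(\<lambda>s. slice_prod F1 F2 F3 F4 (fst s) (snd s)) \<in> borel_measurable borel"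
proof -
  have [measurable]: "(\<lambda>s. slice_ft F1 F4 (fst s) (snd s)) \<in> borel_measurable borel"
    "(\<lambda>s. slice_ft (conjg F2) (conjg F3) (fst s) (snd s)) \<in> borel_measurable borel"
    using assms by (auto intro!: slice_ft_measurable admissible_conjg)
  show ?thesis unfolding slice_prod_def by measurable
qed

lemma slice_prod_bound:
  assumes "admissible F1" "admissible F2" "admissible F3" "admissible F4"
  obtains C where "C \<ge> 0" "\<And>\<xi> q. cmod (slice_prod F1 F2 F3 F4 \<xi> q) \<le> C * (decay (fst q) * decay (snd q))"
proof -
  obtain B where B: "B \<ge> 0" "\<And>\<xi> q. cmod (slice_ft F1 F4 \<xi> q) \<le> B * (decay (fst q) * decay (snd q))"
    using slice_ft_bound assms by metis
  obtain D where D: "D \<ge> 0" "\<And>\<xi> q. cmod (slice_ft (conjg F2) (conjg F3) \<xi> q) \<le> D * (decay (fst q) * decay (snd q))"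
    using slice_ft_bound[of "conjg F2" "conjg F3"] assms admissible_conjg by metis
  have "cmod (slice_prod F1 F2 F3 F4 \<xi> q) \<le> (B * D) * (decay (fst q) * decay (snd q))" for \<xi> q
  proof -
    have "cmod (slice_ft F1 F4 \<xi> q) * cmod (slice_ft (conjg F2) (conjg F3) \<xi> q) \<le> (B * (decay (fst q) * decay (snd q))) * (D * (1 * 1))"
      by (intro mult_mono order_trans[OF B(2)] order_trans[OF D(2)] mult_left_mono B D decay_le_1 mult_nonneg_nonneg) auto
    then show ?thesis by (simp add: slice_prod_def norm_mult mult_ac)
  qed
  then show thesis using that[of "B * D"] B D by auto
qed

lemma integrable_decay2: "integrable lborel (\<lambda>q::real \<times> real. decay (fst q) * decay (snd q))"
  by (rule integrable_tensor[OF integrable_decay integrable_decay])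

lemma entangled_product_eq:
  "entangled_product F1 F2 F3 F4 z =
     F1 (fst z, fst (snd (snd z))) * F2 (fst (snd z), fst (snd (snd z))) *
     F3 (fst (snd z), snd (snd (snd z))) * F4 (fst z, snd (snd (snd z)))"
  by (simp add: entangled_product_def case_prod_beta)

lemma integrable_entangled_product:
  assumes "admissible F1" "admissible F2" "admissible F3" "admissible F4"
  shows "integrable lborel (entangled_product F1 F2 F3 F4)"
proof -
  have [measurable]: "F1 \<in> borel_measurable borel" "F2 \<in> borel_measurable borel" "F3 \<in> borel_measurable borel" "F4 \<in> borel_measurable borel"
    using assms by (auto simp: admissible_def)
  obtain B1 where B1: "B1 \<ge> 0" "\<And>x y. cmod (F1 (x, y)) \<le> B1 * (decay x * decay y)" using admissible_bound assms by metis
  obtain B2 where B2: "B2 \<ge> 0" "\<And>x y. cmod (F2 (x, y)) \<le> B2 * (decay x * decay y)" using admissible_bound assms by metis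
  obtain B3 where B3: "B3 \<ge> 0" "\<And>x y. cmod (F3 (x, y)) \<le> B3 * (decay x * decay y)" using admissible_bound assms by metis
  obtain B4 where B4: "B4 \<ge> 0" "\<And>x y. cmod (F4 (x, y)) \<le> B4 * (decay x * decay y)" using admissible_bound assms by metis
  define D where "D = (\<lambda>z::real \<times> real \<times> real \<times> real. decay (fst z) * (decay (fst (snd z)) * (decay (fst (snd (snd z))) * decay (snd (snd (snd z))))))"
  show ?thesis
  proof (rule Bochner_Integration.integrable_bound)
    have "integrable lborel D" unfolding D_def
      by (intro integrable_tensor[of decay "\<lambda>p. decay (fst p) * (decay (fst (snd p)) * decay (snd (snd p)))"]
            integrable_tensor[of decay "\<lambda>p. decay (fst p) * decay (snd p)"] integrable_decay2 integrable_decay)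
    then show "integrable lborel (\<lambda>z. (B1 * B2 * B3 * B4) * D z)" by simp
    show "entangled_product F1 F2 F3 F4 \<in> borel_measurable lborel"
      unfolding entangled_product_eq[abs_def] by measurable
    have "norm (entangled_product F1 F2 F3 F4 (x, x', y, y')) \<le> norm ((B1 * B2 * B3 * B4) * D (x, x', y, y'))" for x x' y y'
    proof -
      have "cmod (F1 (x, y)) * cmod (F2 (x', y)) * cmod (F3 (x', y')) * cmod (F4 (x, y')) \<le>
         (B1 * (decay x * decay y)) * (B2 * (1 * 1)) * (B3 * (decay x' * decay y')) * (B4 * (1 * 1))"
        by (intro mult_mono order_trans[OF B1(2)] order_trans[OF B2(2)] order_trans[OF B3(2)] order_trans[OF B4(2)] 
            mult_left_mono B1 B2 B3 B4 decay_le_1 mult_nonneg_nonneg) auto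
      also have "\<dots> = (B1 * B2 * B3 * B4) * D (x, x', y, y')" by (simp add: D_def)
      also have "\<dots> \<le> norm ((B1 * B2 * B3 * B4) * D (x, x', y, y'))" by simp
      finally show ?thesis by (simp add: entangled_product_eq norm_mult)
    qed
    then show "AE z in lborel. norm (entangled_product F1 F2 F3 F4 z) \<le> norm ((B1 * B2 * B3 * B4) * D z)" by auto
  qed
qed

lemma diag_ft_unfold:
  "diag_ft F1 F2 F3 F4 p = (LINT z|lborel. entangled_product F1 F2 F3 F4 z *
      wave (fst p * (fst z - fst (snd z)) + snd p * (fst (snd (snd z)) - snd (snd (snd z)))))"
proof -
  have "z \<bullet> (fst p, - fst p, snd p, - snd p)
    = fst p * (fst z - fst (snd z)) + snd p * (fst (snd (snd z)) - snd (snd (snd z)))"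
    for z :: "real \<times> real \<times> real \<times> real"
    unfolding inner_prod_def fst_conv snd_conv inner_real_def by argo
  then show ?thesis unfolding diag_ft_def fourier_transform_def exp_eq_wave by simp
qed

lemma integrable_mult_wave:
  fixes f :: "'a::euclidean_space \<Rightarrow> complex"
  assumes "integrable lborel f" "g \<in> borel_measurable borel"
  shows "integrable lborel (\<lambda>x. f x * wave (g x))"
  by (rule Bochner_Integration.integrable_bound[OF assms(1)])
    (use assms borel_measurable_integrable[OF assms(1)] in \<open>auto simp: norm_mult\<close>)

text \<open>For fixed \<open>(y, y')\<close> the entangled product is a function of \<open>x\<close> times a function of \<open>x'\<close>: the
functions \<open>F1, F4\<close> see only \<open>x\<close> and \<open>F2, F3\<close> see only \<open>x'\<close>. So the integral over \<open>(x, x')\<close>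
factors.\<close>

lemma diag_ft_slice:
  assumes "admissible F1" "admissible F2" "admissible F3" "admissible F4"
  shows "diag_ft F1 F2 F3 F4 p =
    (LINT q|lborel. slice_prod F1 F2 F3 F4 (fst p) q * wave (snd p * (fst q - snd q)))"
proof -
  define g where "g = (\<lambda>z::real \<times> real \<times> real \<times> real. entangled_product F1 F2 F3 F4 z *
      wave (fst p * (fst z - fst (snd z)) + snd p * (fst (snd (snd z)) - snd (snd (snd z)))))"
  have g: "integrable lborel g" unfolding g_def
    by (intro integrable_mult_wave integrable_entangled_product assms) measurable
  then have gm: "g \<in> borel_measurable borel" using borel_measurable_integrable by auto
  have g': "integrable lborel (\<lambda>r. g (fst (fst r), snd (fst r), snd r))"
    using lborel_integral_assoc(2)[OF gm] g by blast
  have "diag_ft F1 F2 F3 F4 p = (LINT z|lborel. g z)" by (simp add: diag_ft_unfold g_def)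
  also have "\<dots> = (LINT r|lborel. g (fst (fst r), snd (fst r), snd r))" using lborel_integral_assoc(1)[OF gm] by simp
  also have "\<dots> = (LINT q|lborel. LINT w|lborel. g (fst w, snd w, q))"
    using lborel_integral_snd[OF g'] by simp
  also have "\<dots> = (LINT q|lborel. slice_prod F1 F2 F3 F4 (fst p) q * wave (snd p * (fst q - snd q)))"
  proof (rule Bochner_Integration.integral_cong)
    fix q :: "real \<times> real"
    define f where "f = (\<lambda>x. F1 (x, fst q) * F4 (x, snd q) * wave (fst p * x))"
    define h where "h = (\<lambda>x. cnj (conjg F2 (x, fst q) * conjg F3 (x, snd q) * wave (fst p * x)))"
    have f: "integrable lborel f" unfolding f_def by (intro slice_integrand_integrable assms)
    have h: "integrable lborel h" unfolding h_def
      by (intro integrable_cnj slice_integrand_integrable admissible_conjg assms)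
    have "wave (fst p * (x - x') + snd p * (fst q - snd q)) = wave (snd p * (fst q - snd q)) * (wave (fst p * x) * cnj (wave (fst p * x')))" for x x'
      unfolding wave_minus[symmetric] wave_add[symmetric] by (simp add: algebra_simps)
    then have "g (fst w, snd w, q) = wave (snd p * (fst q - snd q)) * (f (fst w) * h (snd w))" for w
      by (simp add: g_def f_def h_def entangled_product_eq conjg_def)
    then have "(LINT w|lborel. g (fst w, snd w, q)) = wave (snd p * (fst q - snd q)) * (LINT w|lborel. f (fst w) * h (snd w))"
      by simp
    also have "(LINT w|lborel. f (fst w) * h (snd w)) = integral\<^sup>L lborel f * integral\<^sup>L lborel h"
      by (rule integral_tensor[OF f h])
    also have "\<dots> = slice_prod F1 F2 F3 F4 (fst p) q"
      unfolding slice_prod_def slice_ft_def f_def h_def by (subst Bochner_Integration.integral_cnj) simp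
    finally show "(LINT w|lborel. g (fst w, snd w, q)) = slice_prod F1 F2 F3 F4 (fst p) q * wave (snd p * (fst q - snd q))"
      by simp
  qed simp
  finally show ?thesis .
qed

text \<open>The mirror symmetry of the problem. Exchanging the pairs \<open>(x, x')\<close> and \<open>(y, y')\<close> turns
\<open>F1(x,y) F2(x',y) F3(x',y') F4(x,y')\<close> into the entangled product of the flipped functions, but
\<open>F2\<close> and \<open>F4\<close> change places.\<close>

lemma diag_ft_flip:
  assumes "admissible F1" "admissible F2" "admissible F3" "admissible F4"
  shows "diag_ft (flip F1) (flip F4) (flip F3) (flip F2) (snd p, fst p) = diag_ft F1 F2 F3 F4 p"
proof -
  define g where "g = (\<lambda>z::real \<times> real \<times> real \<times> real. entangled_product F1 F2 F3 F4 z *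
      wave (fst p * (fst z - fst (snd z)) + snd p * (fst (snd (snd z)) - snd (snd (snd z)))))"
  define h where "h = (\<lambda>z::real \<times> real \<times> real \<times> real. entangled_product (flip F1) (flip F4) (flip F3) (flip F2) z *
      wave (snd p * (fst z - fst (snd z)) + fst p * (fst (snd (snd z)) - snd (snd (snd z)))))"
  have "integrable lborel g" unfolding g_def
    by (intro integrable_mult_wave integrable_entangled_product assms) measurable
  then have [measurable]: "g \<in> borel_measurable borel" using borel_measurable_integrable by auto
  have "integrable lborel h" unfolding h_def
    by (intro integrable_mult_wave integrable_entangled_product admissible_flip assms) measurable
  then have [measurable]: "h \<in> borel_measurable borel" using borel_measurable_integrable by auto
  have "diag_ft (flip F1) (flip F4) (flip F3) (flip F2) (snd p, fst p) = (LINT z|lborel. h z)"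
    by (simp add: diag_ft_unfold h_def)
  also have "\<dots> = (LINT r::(real \<times> real) \<times> (real \<times> real)|lborel. h (fst (fst r), snd (fst r), snd r))" 
    by (rule lborel_integral_assoc(1)[symmetric]) measurable
  also have "\<dots> = (LINT r::(real \<times> real) \<times> (real \<times> real)|lborel. g (fst (snd r), snd (snd r), fst r))"
  proof -
    have "h (a, b, c, d) = g (c, d, a, b)" for a b c d
    proof -
      have "entangled_product (flip F1) (flip F4) (flip F3) (flip F2) (a, b, c, d) = entangled_product F1 F2 F3 F4 (c, d, a, b)"
        by (simp add: entangled_product_eq flip_def)
      then show ?thesis by (simp add: g_def h_def add.commute)
    qed
    then have "h (a, b, q) = g (fst q, snd q, a, b)" for a b q by (metis prod.collapse)
    then show ?thesis by (simp only: prod.collapse)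
  qed
  also have "\<dots> = (LINT r::(real \<times> real) \<times> (real \<times> real)|lborel. g (fst (fst r), snd (fst r), snd r))"
    using lborel_integral_swap[of "\<lambda>r::(real \<times> real) \<times> (real \<times> real). g (fst (fst r), snd (fst r), snd r)"] by simp
  also have "\<dots> = (LINT z|lborel. g z)" by (rule lborel_integral_assoc(1)) measurable
  finally show ?thesis by (simp add: diag_ft_unfold g_def)
qed

lemma diag_ft_measurable:
  assumes "admissible F1" "admissible F2" "admissible F3" "admissible F4"
  shows "diag_ft F1 F2 F3 F4 \<in> borel_measurable borel"
proof -
  have [measurable]: "entangled_product F1 F2 F3 F4 \<in> borel_measurable borel" 
    using integrable_entangled_product[OF assms] borel_measurable_integrable by auto
  show ?thesis unfolding diag_ft_unfold[abs_def] by (rule lborel.borel_measurable_lebesgue_integral) measurable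
qed

lemma diag_ft_bounded:
  obtains C where "C \<ge> 0" "\<And>p. cmod (diag_ft F1 F2 F3 F4 p) \<le> C"
proof (rule that)
  show "0 \<le> (LINT z|lborel. norm (entangled_product F1 F2 F3 F4 z))" by simp
  show "cmod (diag_ft F1 F2 F3 F4 p) \<le> (LINT z|lborel. norm (entangled_product F1 F2 F3 F4 z))" for p
    unfolding diag_ft_unfold by (rule order_trans[OF integral_norm_bound]) (simp add: norm_mult)
qed

section \<open>Multipliers as kernels in the second variable\<close>

text \<open>Symbols are functions of \<open>((t, \<xi>), \<eta>)\<close>: the transform concerns \<open>\<eta>\<close> only, while the scale
\<open>t\<close> and the frequency \<open>\<xi>\<close> stay as parameters \<open>p = (t, \<xi>)\<close>.\<close>

definition partial_ft :: "((real \<times> real) \<times> real \<Rightarrow> complex) \<Rightarrow> real \<times> real \<Rightarrow> real \<Rightarrow> complex" where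
  "partial_ft c p v = (LINT \<eta>|lborel. c (p, \<eta>) * wave (\<eta> * v))"

definition slice_form where
  "slice_form F1 F2 F3 F4 k = (LINT r|lborel. slice_prod F1 F2 F3 F4 (snd (fst r)) (snd r) *
      k (fst r) (fst (snd r) - snd (snd r)))"

lemma partial_ft_measurable:
  assumes [measurable]: "c \<in> borel_measurable borel"
  shows "(\<lambda>s. partial_ft c (fst s) (snd s)) \<in> borel_measurable borel"
  unfolding partial_ft_def by (rule lborel.borel_measurable_lebesgue_integral) measurable

text \<open>Insert the factorisation of \<open>diag_ft\<close> and exchange the integrals over \<open>\<eta>\<close> and \<open>(y, y')\<close>. The
scale \<open>t\<close> is integrated out on the multiplier side but kept on the kernel side, since there the
kernel is to be estimated for each \<open>t\<close> separately.\<close>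

lemma form_representation:
  fixes c :: "(real \<times> real) \<times> real \<Rightarrow> complex"
  assumes adm: "admissible F1" "admissible F2" "admissible F3" "admissible F4"
    and c: "integrable lborel c"
  shows integrable_slice_form: "integrable lborel (\<lambda>r. slice_prod F1 F2 F3 F4 (snd (fst r)) (snd r) *
      partial_ft c (fst r) (fst (snd r) - snd (snd r)))"
    and integrable_diag_form: "integrable lborel (\<lambda>s. diag_ft F1 F2 F3 F4 s * (LINT t|lborel. c ((t, fst s), snd s)))"
    and diag_form_eq_slice_form: "(LINT s|lborel. diag_ft F1 F2 F3 F4 s * (LINT t|lborel. c ((t, fst s), snd s)))
      = slice_form F1 F2 F3 F4 (partial_ft c)"
proof -
  let ?W = "slice_prod F1 F2 F3 F4" and ?\<Phi> = "diag_ft F1 F2 F3 F4"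
  have cm[measurable]: "c \<in> borel_measurable borel" using borel_measurable_integrable[OF c] by simp
  have Wm[measurable]: "(\<lambda>s. ?W (fst s) (snd s)) \<in> borel_measurable borel" by (rule slice_prod_measurable[OF adm])
  have \<Phi>m[measurable]: "?\<Phi> \<in> borel_measurable borel" by (rule diag_ft_measurable[OF adm])
  have Pm[measurable]: "(\<lambda>s. partial_ft c (fst s) (snd s)) \<in> borel_measurable borel" by (rule partial_ft_measurable[OF cm])
  obtain C where C: "C \<ge> 0" "\<And>\<xi> q. cmod (?W \<xi> q) \<le> C * (decay (fst q) * decay (snd q))"
    using slice_prod_bound[OF adm] by metis
  obtain B where B: "\<And>p. cmod (?\<Phi> p) \<le> B" using diag_ft_bounded by metis
  define M where "M = (\<lambda>q. C * (decay (fst q) * decay (snd q)))"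
  have M: "integrable lborel M" unfolding M_def using integrable_decay2 by simp
  have Mnn: "0 \<le> M q" for q unfolding M_def using C(1) by simp
  have nc: "integrable lborel (\<lambda>p. LINT \<eta>|lborel. norm (c (p, \<eta>)))"
    using lborel_integrable_fst[OF integrable_norm[OF c]] .
  show int: "integrable lborel (\<lambda>r. ?W (snd (fst r)) (snd r) * partial_ft c (fst r) (fst (snd r) - snd (snd r)))"
  proof (rule Bochner_Integration.integrable_bound[OF integrable_tensor[OF nc M]])
    show "(\<lambda>r. ?W (snd (fst r)) (snd r) * partial_ft c (fst r) (fst (snd r) - snd (snd r))) \<in> borel_measurable lborel"
      using measurable_compose[OF _ Wm, of "\<lambda>r::(real \<times> real) \<times> (real \<times> real). (snd (fst r), snd r)" borel]
        measurable_compose[OF _ Pm, of "\<lambda>r. (fst r, fst (snd r) - snd (snd r))" borel] by simp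
    have "cmod (?W (snd (fst r)) (snd r)) * cmod (partial_ft c (fst r) (fst (snd r) - snd (snd r)))
        \<le> M (snd r) * (LINT \<eta>|lborel. norm (c (fst r, \<eta>)))" for r :: "(real \<times> real) \<times> (real \<times> real)"
    proof (rule mult_mono)
      show "cmod (?W (snd (fst r)) (snd r)) \<le> M (snd r)" using C(2) by (simp add: M_def)
      show "cmod (partial_ft c (fst r) (fst (snd r) - snd (snd r))) \<le> (LINT \<eta>|lborel. norm (c (fst r, \<eta>)))"
        unfolding partial_ft_def by (rule order_trans[OF integral_norm_bound]) (simp add: norm_mult)
      show "0 \<le> M (snd r)" by (rule Mnn)
      show "0 \<le> cmod (partial_ft c (fst r) (fst (snd r) - snd (snd r)))" by simp
    qed
    then have "norm (?W (snd (fst r)) (snd r) * partial_ft c (fst r) (fst (snd r) - snd (snd r)))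
        \<le> norm ((LINT \<eta>|lborel. norm (c (fst r, \<eta>))) * M (snd r))" for r :: "(real \<times> real) \<times> (real \<times> real)"
      using Mnn by (simp add: norm_mult mult.commute[of "M _"])
    then show "AE r in lborel. norm (?W (snd (fst r)) (snd r) * partial_ft c (fst r) (fst (snd r) - snd (snd r)))
       \<le> norm ((LINT \<eta>|lborel. norm (c (fst r, \<eta>))) * M (snd r))"
      by (rule AE_I2)
  qed
  define f where "f = (\<lambda>r::(real \<times> real) \<times> real. ?\<Phi> (snd (fst r), snd r) * c r)"
  have f: "integrable lborel f" unfolding f_def
  proof (rule Bochner_Integration.integrable_bound)
    show "integrable lborel (\<lambda>r. of_real B * c r)" using c by simp
    show "AE r in lborel. norm (?\<Phi> (snd (fst r), snd r) * c r) \<le> norm (of_real B * c r)"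
      by (intro AE_I2) (auto simp: norm_mult intro!: mult_right_mono order_trans[OF B])
  qed measurable
  have fm: "f \<in> borel_measurable borel" using borel_measurable_integrable[OF f] by simp
  have "(LINT r|lborel. f r) = (LINT p|lborel. LINT \<eta>|lborel. f (p, \<eta>))"
    by (rule lborel_integral_fst[OF f, symmetric])
  also have "\<dots> = (LINT p|lborel. LINT q|lborel. ?W (snd p) q * partial_ft c p (fst q - snd q))"
  proof (rule integral_cong_AE)
    show "(\<lambda>p. LINT \<eta>|lborel. f (p, \<eta>)) \<in> borel_measurable lborel"
      using borel_measurable_integrable[OF lborel_integrable_fst[OF f]] .
    show "(\<lambda>p. LINT q|lborel. ?W (snd p) q * partial_ft c p (fst q - snd q)) \<in> borel_measurable lborel"
      using borel_measurable_integrable[OF lborel_integrable_fst[OF int]] by simp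
    show "AE p in lborel. (LINT \<eta>|lborel. f (p, \<eta>)) = (LINT q|lborel. ?W (snd p) q * partial_ft c p (fst q - snd q))"
      using lborel_AE_integrable_fst[OF c]
    proof eventually_elim
      case (elim p)
      define H where "H = (\<lambda>z::real \<times> (real \<times> real). (?W (snd p) (snd z) * c (p, fst z)) * wave (fst z * (fst (snd z) - snd (snd z))))"
      have Wi: "integrable lborel (?W (snd p))"
      proof (rule Bochner_Integration.integrable_bound[OF M])
        show "?W (snd p) \<in> borel_measurable lborel" 
          using measurable_compose[OF _ Wm, of "\<lambda>q. (snd p, q)" borel] by simp
        show "AE q in lborel. norm (?W (snd p) q) \<le> norm (M q)" using C by (auto simp: M_def intro: order_trans[OF C(2)])
      qed
      have H: "integrable lborel H" unfolding H_def
        using integrable_mult_wave[OF integrable_tensor[OF elim Wi], of "\<lambda>z. fst z * (fst (snd z) - snd (snd z))"]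
        by (simp add: mult_ac)
      have "f (p, \<eta>) = (LINT q|lborel. H (\<eta>, q))" for \<eta>
      proof -
        have "f (p, \<eta>) = c (p, \<eta>) * (LINT q|lborel. ?W (snd p) q * wave (\<eta> * (fst q - snd q)))"
          by (simp add: f_def diag_ft_slice[OF adm])
        also have "\<dots> = (LINT q|lborel. c (p, \<eta>) * (?W (snd p) q * wave (\<eta> * (fst q - snd q))))"
          by (rule integral_mult_right_zero[symmetric])
        also have "\<dots> = (LINT q|lborel. H (\<eta>, q))" by (simp add: H_def mult_ac)
        finally show ?thesis .
      qed
      then have "(LINT \<eta>|lborel. f (p, \<eta>)) = (LINT \<eta>|lborel. LINT q|lborel. H (\<eta>, q))" by simp
      also have "\<dots> = (LINT q|lborel. LINT \<eta>|lborel. H (\<eta>, q))"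
        unfolding lborel_integral_fst[OF H] lborel_integral_snd[OF H] by (rule refl)
      also have "\<dots> = (LINT q|lborel. ?W (snd p) q * partial_ft c p (fst q - snd q))"
        unfolding H_def partial_ft_def by (simp add: mult.assoc)
      finally show ?case .
    qed
  qed
  also have "\<dots> = slice_form F1 F2 F3 F4 (partial_ft c)"
    using lborel_integral_fst[OF int] by (simp add: slice_form_def)
  finally have eq: "(LINT r|lborel. f r) = slice_form F1 F2 F3 F4 (partial_ft c)" .
  define g where "g = (\<lambda>z::real \<times> (real \<times> real). ?\<Phi> (snd z) * c ((fst z, fst (snd z)), snd (snd z)))"
  have gm: "g \<in> borel_measurable borel" unfolding g_def by measurable
  have gf: "(\<lambda>r. g (fst (fst r), snd (fst r), snd r)) = f" by (simp add: g_def f_def)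
  have g: "integrable lborel g" using lborel_integral_assoc(2)[OF gm] f by (simp add: gf)
  have gf': "(LINT z|lborel. g z) = (LINT r|lborel. f r)" using lborel_integral_assoc(1)[OF gm] by (simp add: gf)
  show "integrable lborel (\<lambda>s. ?\<Phi> s * (LINT t|lborel. c ((t, fst s), snd s)))"
    using lborel_integrable_snd[OF g] by (simp add: g_def)
  show "(LINT s|lborel. ?\<Phi> s * (LINT t|lborel. c ((t, fst s), snd s))) = slice_form F1 F2 F3 F4 (partial_ft c)"
    using lborel_integral_snd[OF g] by (simp add: g_def[abs_def] gf'[unfolded g_def] eq)
qed

text \<open>A multiplier is split as one symbol for the pair \<open>(\<xi>, \<eta>)\<close> and one for \<open>(\<eta>, \<xi>)\<close>; by the mirror
symmetry the second one is a form of the first kind for the flipped functions.\<close>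

lemma symmetric_form_representation:
  fixes c c' :: "(real \<times> real) \<times> real \<Rightarrow> complex"
  assumes adm: "admissible F1" "admissible F2" "admissible F3" "admissible F4"
    and c: "integrable lborel c" "integrable lborel c'"
  shows "(LINT s|lborel. diag_ft F1 F2 F3 F4 s *
        ((LINT t|lborel. c ((t, fst s), snd s)) + (LINT t|lborel. c' ((t, snd s), fst s))))
      = slice_form F1 F2 F3 F4 (partial_ft c) +
        slice_form (flip F1) (flip F4) (flip F3) (flip F2) (partial_ft c')"
proof -
  let ?\<Phi> = "diag_ft F1 F2 F3 F4" and ?\<Psi> = "diag_ft (flip F1) (flip F4) (flip F3) (flip F2)"
  note adm' = admissible_flip[OF adm(1)] admissible_flip[OF adm(4)] admissible_flip[OF adm(3)] admissible_flip[OF adm(2)]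
  note i = integrable_diag_form[OF adm c(1)]
  note i' = integrable_diag_form[OF adm' c(2)]
  have sw: "?\<Psi> (snd s, fst s) = ?\<Phi> s" for s by (rule diag_ft_flip[OF adm])
  have i'': "integrable lborel (\<lambda>s. ?\<Phi> s * (LINT t|lborel. c' ((t, snd s), fst s)))"
    using integrable_lborel_swap[OF i'] by (simp add: sw)
  have "(LINT s|lborel. ?\<Phi> s * ((LINT t|lborel. c ((t, fst s), snd s)) + (LINT t|lborel. c' ((t, snd s), fst s))))
     = (LINT s|lborel. ?\<Phi> s * (LINT t|lborel. c ((t, fst s), snd s))) + (LINT s|lborel. ?\<Phi> s * (LINT t|lborel. c' ((t, snd s), fst s)))"
    unfolding distrib_left by (rule Bochner_Integration.integral_add[OF i i''])
  also have "(LINT s|lborel. ?\<Phi> s * (LINT t|lborel. c' ((t, snd s), fst s))) = (LINT s|lborel. ?\<Psi> s * (LINT t|lborel. c' ((t, fst s), snd s)))"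
    using lborel_integral_swap[of "\<lambda>s. ?\<Psi> s * (LINT t|lborel. c' ((t, fst s), snd s))"] borel_measurable_integrable[OF i']
    by (simp add: sw)
  finally show ?thesis unfolding diag_form_eq_slice_form[OF adm c(1)] diag_form_eq_slice_form[OF adm' c(2)] .
qed

section \<open>Hoelder bound for Poisson averages\<close>

lemma Cauchy_Schwarz_integral:
  fixes f g :: "'a \<Rightarrow> real"
  assumes [measurable]: "f \<in> borel_measurable M" "g \<in> borel_measurable M"
    and f: "integrable M (\<lambda>x. (f x)\<^sup>2)" and g: "integrable M (\<lambda>x. (g x)\<^sup>2)"
    and nn: "\<And>x. f x \<ge> 0" "\<And>x. g x \<ge> 0"
  shows "integrable M (\<lambda>x. f x * g x)"
    and "(LINT x|M. f x * g x) \<le> sqrt (LINT x|M. (f x)\<^sup>2) * sqrt (LINT x|M. (g x)\<^sup>2)"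
proof -
  have fg: "f x * g x \<le> (f x)\<^sup>2 + (g x)\<^sup>2" for x
    using sum_squares_bound[of "f x" "g x"] nn[of x] mult_nonneg_nonneg[of "f x" "g x"] by linarith
  show i: "integrable M (\<lambda>x. f x * g x)"
    by (rule Bochner_Integration.integrable_bound[OF Bochner_Integration.integrable_add[OF f g]])
      (use fg nn in \<open>auto simp: abs_mult\<close>)
  have "(\<integral>\<^sup>+x. ennreal (f x) * ennreal (g x) \<partial>M)\<^sup>2 \<le> (\<integral>\<^sup>+x. (ennreal (f x))\<^sup>2 \<partial>M) * (\<integral>\<^sup>+x. (ennreal (g x))\<^sup>2 \<partial>M)"
    by (rule Cauchy_Schwarz_nn_integral) auto
  then have "(\<integral>\<^sup>+x. ennreal (f x * g x) \<partial>M)\<^sup>2 \<le> (\<integral>\<^sup>+x. ennreal ((f x)\<^sup>2) \<partial>M) * (\<integral>\<^sup>+x. ennreal ((g x)\<^sup>2) \<partial>M)"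
    using nn by (simp add: ennreal_mult ennreal_power)
  then have "(ennreal (LINT x|M. f x * g x))\<^sup>2 \<le> ennreal (LINT x|M. (f x)\<^sup>2) * ennreal (LINT x|M. (g x)\<^sup>2)"
    using nn by (simp add: nn_integral_eq_integral i f g)
  then have "(LINT x|M. f x * g x)\<^sup>2 \<le> (LINT x|M. (f x)\<^sup>2) * (LINT x|M. (g x)\<^sup>2)"
    using nn by (simp add: ennreal_power integral_nonneg flip: ennreal_mult)
  then have "sqrt ((LINT x|M. f x * g x)\<^sup>2) \<le> sqrt ((LINT x|M. (f x)\<^sup>2) * (LINT x|M. (g x)\<^sup>2))"
    by (rule real_sqrt_le_mono)
  then show "(LINT x|M. f x * g x) \<le> sqrt (LINT x|M. (f x)\<^sup>2) * sqrt (LINT x|M. (g x)\<^sup>2)"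
    using nn by (simp add: real_sqrt_mult integral_nonneg)
qed

lemma nn_integral_lborel_pair_fst:
  fixes f :: "'a::euclidean_space \<times> 'b::euclidean_space \<Rightarrow> ennreal"
  assumes "f \<in> borel_measurable borel"
  shows "(\<integral>\<^sup>+p. f p \<partial>lborel) = (\<integral>\<^sup>+x. \<integral>\<^sup>+y. f (x, y) \<partial>lborel \<partial>lborel)"
    and "(\<integral>\<^sup>+p. f p \<partial>lborel) = (\<integral>\<^sup>+y. \<integral>\<^sup>+x. f (x, y) \<partial>lborel \<partial>lborel)"
proof -
  have f: "f \<in> borel_measurable (lborel \<Otimes>\<^sub>M lborel)" using assms by (simp add: lborel_prod)
  show "(\<integral>\<^sup>+p. f p \<partial>lborel) = (\<integral>\<^sup>+x. \<integral>\<^sup>+y. f (x, y) \<partial>lborel \<partial>lborel)"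
    using lborel.nn_integral_fst[OF f] by (simp add: lborel_prod)
  show "(\<integral>\<^sup>+p. f p \<partial>lborel) = (\<integral>\<^sup>+y. \<integral>\<^sup>+x. f (x, y) \<partial>lborel \<partial>lborel)"
    using lborel_pair.nn_integral_snd[of f] f by (simp add: lborel_prod)
qed

lemma borel_measurable_poisson[measurable]: "(\<lambda>p. poisson (fst p) (snd p)) \<in> borel_measurable borel"
  unfolding poisson_def by measurable

lemma borel_measurable_poisson1[measurable]: "poisson t \<in> borel_measurable borel"
  unfolding poisson_def[abs_def] by measurable

lemma nn_integral_poisson:
  assumes "t > 0"
  shows "(\<integral>\<^sup>+y. ennreal (poisson t (x - y)) \<partial>lborel) = 1" "(\<integral>\<^sup>+x. ennreal (poisson t (x - y)) \<partial>lborel) = 1"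
proof -
  have "(\<integral>\<^sup>+v. ennreal (poisson t v) \<partial>lborel) = 1"
    using nn_integral_eq_integral[OF integrable_poisson[OF assms]] poisson_nonneg[OF assms] integral_poisson[OF assms] by simp
  then show "(\<integral>\<^sup>+y. ennreal (poisson t (x - y)) \<partial>lborel) = 1" "(\<integral>\<^sup>+x. ennreal (poisson t (x - y)) \<partial>lborel) = 1"
    using nn_integral_real_affine[of "\<lambda>v. ennreal (poisson t v)" "-1" x]
      nn_integral_real_affine[of "\<lambda>v. ennreal (poisson t v)" "1" "- y"] by simp_all
qed

lemma nn_integral_poisson_marginal:
  assumes t: "t > 0" and [measurable]: "h \<in> borel_measurable borel" and pick: "pick = fst \<or> pick = snd"
  shows "(\<integral>\<^sup>+p. h (pick p) * ennreal (poisson t (fst p - snd p)) \<partial>lborel) = (\<integral>\<^sup>+x. h x \<partial>lborel)"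
  using pick
proof
  assume p: "pick = fst"
  show ?thesis unfolding p
    by (subst nn_integral_lborel_pair_fst(1), measurable) (simp add: nn_integral_cmult nn_integral_poisson[OF t])
next
  assume p: "pick = snd"
  show ?thesis unfolding p
    by (subst nn_integral_lborel_pair_fst(2), measurable) (simp add: nn_integral_cmult nn_integral_poisson[OF t])
qed

text \<open>Each of the four functions of the entangled product depends on one variable from each pair. The
variables it does not see are integrated against a probability density, so the weighted integral
collapses to a plain integral over the plane. The parameters \<open>pick\<close> and \<open>pick'\<close> select the variables
seen, so that one statement serves all four functions.\<close>

lemma nn_integral_poisson_marginal2:
  assumes t: "t > 0" and [measurable]: "h \<in> borel_measurable borel"
    and pick: "pick = fst \<or> pick = snd" "pick' = fst \<or> pick' = snd"
  shows "(\<integral>\<^sup>+z. h (pick (fst z, fst (snd z)), pick' (snd (snd z))) *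
       ennreal (poisson t (fst z - fst (snd z)) * poisson t (fst (snd (snd z)) - snd (snd (snd z)))) \<partial>lborel)
     = (\<integral>\<^sup>+p. h p \<partial>lborel)"
proof -
  have [measurable]: "pick \<in> borel_measurable borel" "pick' \<in> borel_measurable borel" using pick by auto
  let ?k = "\<lambda>p::real \<times> real. ennreal (poisson t (fst p - snd p))"
  define g where "g = (\<lambda>z::real \<times> real \<times> real \<times> real. h (pick (fst z, fst (snd z)), pick' (snd (snd z))) *
       (?k (fst z, fst (snd z)) * ?k (snd (snd z))))"
  have m: "(\<lambda>r::(real \<times> real) \<times> (real \<times> real). (fst (fst r), snd (fst r), snd r)) \<in> lborel \<rightarrow>\<^sub>M borel" by measurable
  have [measurable]: "g \<in> borel_measurable borel" unfolding g_def by measurable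
  have "(\<integral>\<^sup>+z. h (pick (fst z, fst (snd z)), pick' (snd (snd z))) *
       ennreal (poisson t (fst z - fst (snd z)) * poisson t (fst (snd (snd z)) - snd (snd (snd z)))) \<partial>lborel) =
     (\<integral>\<^sup>+z. g z \<partial>lborel)"
    using t by (simp add: g_def ennreal_mult poisson_nonneg)
  also have "\<dots> = (\<integral>\<^sup>+r. g (fst (fst r), snd (fst r), snd r) \<partial>lborel)"
    using nn_integral_distr[OF m, of g] by (simp add: lborel_distr_assoc)
  also have "\<dots> = (\<integral>\<^sup>+p. \<integral>\<^sup>+q. h (pick p, pick' q) * (?k p * ?k q) \<partial>lborel \<partial>lborel)"
    by (subst nn_integral_lborel_pair_fst(1), measurable) (simp add: g_def)
  also have "\<dots> = (\<integral>\<^sup>+p. (\<integral>\<^sup>+q. h (pick p, pick' q) * ?k q \<partial>lborel) * ?k p \<partial>lborel)"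
  proof (rule nn_integral_cong)
    fix p :: "real \<times> real"
    have "(\<integral>\<^sup>+q. h (pick p, pick' q) * (?k p * ?k q) \<partial>lborel) = (\<integral>\<^sup>+q. (h (pick p, pick' q) * ?k q) * ?k p \<partial>lborel)"
      by (simp add: mult_ac)
    also have "\<dots> = (\<integral>\<^sup>+q. h (pick p, pick' q) * ?k q \<partial>lborel) * ?k p"
      by (rule nn_integral_multc) measurable
    finally show "(\<integral>\<^sup>+q. h (pick p, pick' q) * (?k p * ?k q) \<partial>lborel) = (\<integral>\<^sup>+q. h (pick p, pick' q) * ?k q \<partial>lborel) * ?k p" .
  qed
  also have "\<dots> = (\<integral>\<^sup>+p. (\<integral>\<^sup>+y. h (pick p, y) \<partial>lborel) * ?k p \<partial>lborel)"
  proof (rule nn_integral_cong)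
    fix p :: "real \<times> real"
    have "(\<lambda>y. h (pick p, y)) \<in> borel_measurable borel" by measurable
    from nn_integral_poisson_marginal[OF t this pick(2)]
    show "(\<integral>\<^sup>+q. h (pick p, pick' q) * ?k q \<partial>lborel) * ?k p = (\<integral>\<^sup>+y. h (pick p, y) \<partial>lborel) * ?k p"
      by (rule arg_cong)
  qed
  also have "\<dots> = (\<integral>\<^sup>+x. \<integral>\<^sup>+y. h (x, y) \<partial>lborel \<partial>lborel)"
    by (rule nn_integral_poisson_marginal[OF t _ pick(1)]) measurable
  also have "\<dots> = (\<integral>\<^sup>+p. h p \<partial>lborel)"
    by (rule nn_integral_lborel_pair_fst(1)[symmetric]) measurable
  finally show ?thesis .
qed

lemma am_gm4:
  fixes a b c d :: real
  shows "a * b * c * d \<le> (a ^ 4 + b ^ 4 + c ^ 4 + d ^ 4) / 4"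
proof -
  have s: "x * y \<le> (x\<^sup>2 + y\<^sup>2) / 2" for x y :: real using sum_squares_bound[of x y] by (simp add: field_simps)
  have "(a * b) * (c * d) \<le> ((a * b)\<^sup>2 + (c * d)\<^sup>2) / 2" by (rule s)
  also have "\<dots> = (a\<^sup>2 * b\<^sup>2 + c\<^sup>2 * d\<^sup>2) / 2" by (simp add: power_mult_distrib)
  also have "\<dots> \<le> (((a\<^sup>2)\<^sup>2 + (b\<^sup>2)\<^sup>2) / 2 + ((c\<^sup>2)\<^sup>2 + (d\<^sup>2)\<^sup>2) / 2) / 2"
    by (intro divide_right_mono add_mono s) auto
  also have "\<dots> = (a ^ 4 + b ^ 4 + c ^ 4 + d ^ 4) / 4" by (simp add: field_simps)
  finally show ?thesis by (simp add: mult.assoc)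
qed

lemma Lp_norm_nonneg: "Lp_norm p F \<ge> 0" by (simp add: Lp_norm_def)

lemma Lp_norm_4_power:
  fixes F :: "real \<times> real \<Rightarrow> complex"
  assumes "admissible F"
  shows "(\<integral>\<^sup>+p. ennreal (cmod (F p) ^ 4) \<partial>lborel) = ennreal (Lp_norm 4 F ^ 4)"
proof -
  have [measurable]: "F \<in> borel_measurable borel" by (rule admissible_measurable[OF assms])
  obtain B where B: "B \<ge> 0" "\<And>x y. cmod (F (x, y)) \<le> B * (decay x * decay y)" using admissible_bound[OF assms] by metis
  have i: "integrable lborel (\<lambda>p. cmod (F p) ^ 4)"
  proof (rule Bochner_Integration.integrable_bound)
    show "integrable lborel (\<lambda>q. B ^ 4 * (decay (fst q) * decay (snd q)))" using integrable_decay2 by simp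
    have "cmod (F (x, y)) ^ 4 \<le> B ^ 4 * (decay x * decay y)" for x y
    proof -
      have "cmod (F (x, y)) ^ 4 \<le> (B * (decay x * decay y)) ^ 4" by (intro power_mono B) auto
      also have "\<dots> = B ^ 4 * (decay x * decay y) ^ 4" by (simp add: power_mult_distrib)
      also have "\<dots> \<le> B ^ 4 * (decay x * decay y) ^ 1"
        by (intro mult_left_mono power_decreasing) (auto intro: mult_le_one decay_le_1 simp: B)
      finally show ?thesis by simp
    qed
    then show "AE p in lborel. norm (cmod (F p) ^ 4) \<le> norm (B ^ 4 * (decay (fst p) * decay (snd p)))"
      by (intro AE_I2) (auto simp: B(1) abs_mult)
  qed measurable
  have "Lp_norm 4 F ^ 4 = (LINT p|lborel. cmod (F p) ^ 4)"
  proof -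
    have "Lp_norm 4 F = (LINT p|lborel. cmod (F p) ^ 4) powr (1 / 4)"
    proof -
      have "cmod z powr 4 = cmod z ^ 4" for z by (cases "z = 0") auto
      then show ?thesis by (simp add: Lp_norm_def)
    qed
    moreover have "(x powr (1 / 4)) ^ 4 = x" if "x \<ge> 0" for x :: real
    proof (cases "x = 0")
      case False
      have "(x powr (1 / 4)) powr 4 = x" using that by (simp add: powr_powr)
      then show ?thesis using that False by simp
    qed simp
    ultimately show ?thesis by simp
  qed
  with i show ?thesis by (simp add: nn_integral_eq_integral)
qed

text \<open>The form of the multiplier \<open>e^{-t(|\<xi>|+|\<eta>|)}\<close>, the quantity that telescopes.\<close>

definition poisson_mean where
  "poisson_mean F1 F2 F3 F4 t = (LINT s|lborel. diag_ft F1 F2 F3 F4 s *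
     complex_of_real (exp (- (t * \<bar>fst s\<bar>)) * exp (- (t * \<bar>snd s\<bar>))))"

text \<open>Both exponentials turn into Poisson kernels, so \<open>poisson_mean\<close> averages the entangled product
over \<open>x - x'\<close> and \<open>y - y'\<close> with a probability density.\<close>

lemma poisson_mean_spatial:
  assumes adm: "admissible F1" "admissible F2" "admissible F3" "admissible F4" and t: "t > 0"
  shows "poisson_mean F1 F2 F3 F4 t = (LINT z|lborel. entangled_product F1 F2 F3 F4 z *
     complex_of_real (poisson t (fst z - fst (snd z)) * poisson t (fst (snd (snd z)) - snd (snd (snd z)))))"
proof -
  let ?E = "entangled_product F1 F2 F3 F4"
  let ?e = "\<lambda>x::real. complex_of_real (exp (- (t * \<bar>x\<bar>)))"
  let ?a = "\<lambda>z::real \<times> real \<times> real \<times> real. fst z - fst (snd z)"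
  let ?b = "\<lambda>z::real \<times> real \<times> real \<times> real. fst (snd (snd z)) - snd (snd (snd z))"
  define H where "H = (\<lambda>w::(real \<times> real) \<times> (real \<times> real \<times> real \<times> real). 
     ((?e (fst (fst w)) * ?e (snd (fst w))) * ?E (snd w)) * wave (fst (fst w) * ?a (snd w) + snd (fst w) * ?b (snd w)))"
  have e: "integrable lborel ?e" using integrable_exp_abs[OF t] by simp
  have ee: "integrable lborel (\<lambda>s::real \<times> real. ?e (fst s) * ?e (snd s))" by (rule integrable_tensor[OF e e])
  have H: "integrable lborel H" unfolding H_def
    by (intro integrable_mult_wave integrable_tensor[OF ee integrable_entangled_product[OF adm]]) measurable
  have "poisson_mean F1 F2 F3 F4 t = (LINT s|lborel. LINT z|lborel. H (s, z))"
  proof -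
    have "diag_ft F1 F2 F3 F4 s * complex_of_real (exp (- (t * \<bar>fst s\<bar>)) * exp (- (t * \<bar>snd s\<bar>)))
      = (LINT z|lborel. H (s, z))" for s
    proof -
      have "diag_ft F1 F2 F3 F4 s * complex_of_real (exp (- (t * \<bar>fst s\<bar>)) * exp (- (t * \<bar>snd s\<bar>)))
        = (?e (fst s) * ?e (snd s)) * (LINT z|lborel. ?E z * wave (fst s * ?a z + snd s * ?b z))"
        unfolding diag_ft_unfold of_real_mult by (rule mult.commute)
      also have "\<dots> = (LINT z|lborel. (?e (fst s) * ?e (snd s)) * (?E z * wave (fst s * ?a z + snd s * ?b z)))"
        by (rule integral_mult_right_zero[symmetric])
      also have "\<dots> = (LINT z|lborel. H (s, z))" by (simp add: H_def mult.assoc)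
      finally show ?thesis .
    qed
    then show ?thesis unfolding poisson_mean_def by (simp only:)
  qed
  also have "\<dots> = (LINT z|lborel. LINT s|lborel. H (s, z))"
    unfolding lborel_integral_fst[OF H] lborel_integral_snd[OF H] by (rule refl)
  also have "\<dots> = (LINT z|lborel. ?E z * complex_of_real (poisson t (?a z) * poisson t (?b z)))"
  proof -
    have "(LINT s|lborel. H (s, z)) = ?E z * complex_of_real (poisson t (?a z) * poisson t (?b z))" for z
    proof -
      have "(LINT s|lborel. H (s, z)) = (LINT s|lborel. ?E z * ((?e (fst s) * wave (?a z * fst s)) * (?e (snd s) * wave (?b z * snd s))))"
        by (simp add: H_def wave_add mult_ac)
      also have "\<dots> = ?E z * (LINT s|lborel. (?e (fst s) * wave (?a z * fst s)) * (?e (snd s) * wave (?b z * snd s)))"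
        by (rule integral_mult_right_zero)
      also have "(LINT s|lborel. (?e (fst s) * wave (?a z * fst s)) * (?e (snd s) * wave (?b z * snd s)))
        = (LINT x|lborel. ?e x * wave (?a z * x)) * (LINT y|lborel. ?e y * wave (?b z * y))"
        by (intro integral_tensor[of "\<lambda>x. ?e x * wave (?a z * x)" "\<lambda>x. ?e x * wave (?b z * x)"] integrable_mult_wave[OF e]) measurable
      finally show ?thesis by (simp add: fourier_exp_abs[OF t])
    qed
    then show ?thesis by (simp only:)
  qed
  finally show ?thesis .
qed

text \<open>Hoelder with four exponents \<open>4\<close>, obtained from the arithmetic-geometric mean inequality applied
to the normalised functions \<open>F_j / a_j\<close>; by \<open>nn_integral_poisson_marginal2\<close> each of the four
terms then contributes at most \<open>1 / 4\<close>.\<close>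

lemma poisson_mean_bound:
  assumes adm: "admissible F1" "admissible F2" "admissible F3" "admissible F4" and t: "t > 0"
  shows "cmod (poisson_mean F1 F2 F3 F4 t) \<le> Lp_norm 4 F1 * Lp_norm 4 F2 * Lp_norm 4 F3 * Lp_norm 4 F4"
proof -
  let ?E = "entangled_product F1 F2 F3 F4"
  let ?K = "\<lambda>z::real \<times> real \<times> real \<times> real. poisson t (fst z - fst (snd z)) * poisson t (fst (snd (snd z)) - snd (snd (snd z)))"
  have K: "?K z \<ge> 0" for z using poisson_nonneg[OF t] by simp
  note [measurable] = adm[THEN admissible_measurable]
  \<comment> \<open>The norms are enlarged by \<open>d > 0\<close> so that division by them is possible even if they vanish.\<close>
  have key: "cmod (poisson_mean F1 F2 F3 F4 t) \<le> (Lp_norm 4 F1 + d) * (Lp_norm 4 F2 + d) * (Lp_norm 4 F3 + d) * (Lp_norm 4 F4 + d)"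
    if d: "d > 0" for d
  proof -
    define a1 a2 a3 a4 where a: "a1 = Lp_norm 4 F1 + d" "a2 = Lp_norm 4 F2 + d" "a3 = Lp_norm 4 F3 + d" "a4 = Lp_norm 4 F4 + d"
    have pos: "a1 > 0" "a2 > 0" "a3 > 0" "a4 > 0" using d Lp_norm_nonneg[of 4 F1] Lp_norm_nonneg[of 4 F2] Lp_norm_nonneg[of 4 F3] Lp_norm_nonneg[of 4 F4]
      by (auto simp: a intro: add_nonneg_pos)
    define P where "P = a1 * a2 * a3 * a4"
    have P: "P > 0" using pos by (simp add: P_def)
    define h where "h = (\<lambda>(F :: real \<times> real \<Rightarrow> complex) a p. ennreal ((cmod (F p) / a) ^ 4) :: ennreal)"
    have hm[measurable]: "h F a \<in> borel_measurable borel" if "F \<in> borel_measurable borel" for F :: "real \<times> real \<Rightarrow> complex" and a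
      using that unfolding h_def by measurable
    have h1: "(\<integral>\<^sup>+p. h F a p \<partial>lborel) \<le> 1" if "admissible F" "a = Lp_norm 4 F + d" for F a
    proof -
      have ap: "a > 0" using d Lp_norm_nonneg[of 4 F] that by linarith
      have [measurable]: "F \<in> borel_measurable borel" using that by (simp add: admissible_measurable)
      have "(\<integral>\<^sup>+p. h F a p \<partial>lborel) = (\<integral>\<^sup>+p. ennreal (1 / a ^ 4) * ennreal (cmod (F p) ^ 4) \<partial>lborel)"
        using ap by (simp add: h_def power_divide flip: ennreal_mult)
      also have "\<dots> = ennreal (1 / a ^ 4) * ennreal (Lp_norm 4 F ^ 4)"
        using Lp_norm_4_power[OF that(1)] by (subst nn_integral_cmult) auto
      also have "\<dots> = ennreal (Lp_norm 4 F ^ 4 / a ^ 4)" using ap by (simp flip: ennreal_mult add: Lp_norm_nonneg)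
      also have "\<dots> \<le> ennreal 1"
        using ap d that Lp_norm_nonneg[of 4 F] by (intro ennreal_leI) (auto intro!: power_mono simp: divide_le_eq)
      finally show ?thesis by simp
    qed
    let ?h1 = "\<lambda>z. h F1 a1 (fst (fst z, fst (snd z)), fst (snd (snd z)))"
    let ?h2 = "\<lambda>z. h F2 a2 (snd (fst z, fst (snd z)), fst (snd (snd z)))"
    let ?h3 = "\<lambda>z. h F3 a3 (snd (fst z, fst (snd z)), snd (snd (snd z)))"
    let ?h4 = "\<lambda>z. h F4 a4 (fst (fst z, fst (snd z)), snd (snd (snd z)))"
    have pt: "ennreal (cmod (?E z * complex_of_real (?K z))) \<le> ennreal (P / 4) * (?h1 z * ennreal (?K z) + ?h2 z * ennreal (?K z) + ?h3 z * ennreal (?K z) + ?h4 z * ennreal (?K z))" for z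
    proof -
      define f1 f2 f3 f4 where f: "f1 = cmod (F1 (fst z, fst (snd (snd z))))" "f2 = cmod (F2 (fst (snd z), fst (snd (snd z))))"
        "f3 = cmod (F3 (fst (snd z), snd (snd (snd z))))" "f4 = cmod (F4 (fst z, snd (snd (snd z))))"
      define k where "k = ?K z"
      have k: "k \<ge> 0" unfolding k_def by (rule K)
      have "f1 * f2 * f3 * f4 = P * ((f1 / a1) * (f2 / a2) * (f3 / a3) * (f4 / a4))" using pos by (simp add: P_def)
      also have "\<dots> \<le> P * (((f1 / a1) ^ 4 + (f2 / a2) ^ 4 + (f3 / a3) ^ 4 + (f4 / a4) ^ 4) / 4)"
        using P by (intro mult_left_mono am_gm4) auto
      finally have "f1 * f2 * f3 * f4 * k \<le> P * (((f1 / a1) ^ 4 + (f2 / a2) ^ 4 + (f3 / a3) ^ 4 + (f4 / a4) ^ 4) / 4) * k"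
        by (rule mult_right_mono[OF _ k])
      also have "\<dots> = P / 4 * ((f1 / a1) ^ 4 * k + (f2 / a2) ^ 4 * k + (f3 / a3) ^ 4 * k + (f4 / a4) ^ 4 * k)"
        by (simp add: algebra_simps)
      finally have "ennreal (f1 * f2 * f3 * f4 * k) \<le> ennreal (P / 4 * ((f1 / a1) ^ 4 * k + (f2 / a2) ^ 4 * k + (f3 / a3) ^ 4 * k + (f4 / a4) ^ 4 * k))"
        by (rule ennreal_leI)
      also have "\<dots> = ennreal (P / 4) * (ennreal ((f1 / a1) ^ 4) * ennreal k + ennreal ((f2 / a2) ^ 4) * ennreal k + ennreal ((f3 / a3) ^ 4) * ennreal k + ennreal ((f4 / a4) ^ 4) * ennreal k)"
        using P k pos by (simp add: f flip: ennreal_mult ennreal_plus)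
      finally show ?thesis unfolding norm_mult norm_of_real abs_of_nonneg[OF K]
        by (simp add: entangled_product_eq norm_mult h_def f k_def)
    qed
    have "ennreal (cmod (poisson_mean F1 F2 F3 F4 t)) \<le> (\<integral>\<^sup>+z. ennreal (cmod (?E z * complex_of_real (?K z))) \<partial>lborel)"
      unfolding poisson_mean_spatial[OF adm t]
      by (cases "integrable lborel (\<lambda>z. ?E z * complex_of_real (?K z))")
        (auto intro: integral_norm_bound_ennreal simp: not_integrable_integral_eq)
    also have "\<dots> \<le> (\<integral>\<^sup>+z. ennreal (P / 4) * (?h1 z * ennreal (?K z) + ?h2 z * ennreal (?K z) + ?h3 z * ennreal (?K z) + ?h4 z * ennreal (?K z)) \<partial>lborel)"
      by (rule nn_integral_mono) (rule pt)
    also have "\<dots> = ennreal (P / 4) * ((\<integral>\<^sup>+z. ?h1 z * ennreal (?K z) \<partial>lborel) + (\<integral>\<^sup>+z. ?h2 z * ennreal (?K z) \<partial>lborel)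
      + (\<integral>\<^sup>+z. ?h3 z * ennreal (?K z) \<partial>lborel) + (\<integral>\<^sup>+z. ?h4 z * ennreal (?K z) \<partial>lborel))"
      by (subst nn_integral_cmult, measurable) (subst nn_integral_add, measurable)+
    also have "\<dots> = ennreal (P / 4) * ((\<integral>\<^sup>+p. h F1 a1 p \<partial>lborel) + (\<integral>\<^sup>+p. h F2 a2 p \<partial>lborel) + (\<integral>\<^sup>+p. h F3 a3 p \<partial>lborel) + (\<integral>\<^sup>+p. h F4 a4 p \<partial>lborel))"
      by (subst (1 2 3 4) nn_integral_poisson_marginal2[OF t]) auto
    also have "\<dots> \<le> ennreal (P / 4) * (1 + 1 + 1 + 1)"
      by (intro mult_left_mono add_mono h1 adm a) auto
    also have "(1 + 1 + 1 + 1 :: ennreal) = ennreal 4" by simp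
    also have "ennreal (P / 4) * ennreal 4 = ennreal P" using P by (subst ennreal_mult[symmetric]) auto
    finally show ?thesis using P by (simp add: P_def a)
  qed
  have "((\<lambda>d. (Lp_norm 4 F1 + d) * (Lp_norm 4 F2 + d) * (Lp_norm 4 F3 + d) * (Lp_norm 4 F4 + d)) \<longlongrightarrow>
      (Lp_norm 4 F1 + 0) * (Lp_norm 4 F2 + 0) * (Lp_norm 4 F3 + 0) * (Lp_norm 4 F4 + 0)) (at_right 0)"
    by (intro tendsto_intros)
  then have "cmod (poisson_mean F1 F2 F3 F4 t) \<le> (Lp_norm 4 F1 + 0) * (Lp_norm 4 F2 + 0) * (Lp_norm 4 F3 + 0) * (Lp_norm 4 F4 + 0)"
    by (rule tendsto_lowerbound) (auto simp: eventually_at_right_less intro!: eventually_mono[OF eventually_at_right_less[of 0]] key)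
  then show ?thesis by simp
qed

section \<open>Telescoping and the square functions\<close>

definition abs_weight :: "real \<Rightarrow> real \<Rightarrow> real \<times> real \<Rightarrow> real" where
  "abs_weight e R p = indicator {e..R} (fst p) * (\<bar>snd p\<bar> * exp (- (fst p * \<bar>snd p\<bar>)))"

definition poisson_weight :: "real \<Rightarrow> real \<Rightarrow> real \<times> real \<Rightarrow> real \<Rightarrow> real" where
  "poisson_weight e R p v = abs_weight e R p * poisson (fst p) v"

text \<open>The model symbol \<open>|\<xi>| e^{-t|\<xi>|} e^{-t|\<eta>|}\<close> for \<open>t \<in> [e, R]\<close>, whose transform in \<open>\<eta>\<close> is
\<open>poisson_weight\<close>.\<close>

definition poisson_symbol :: "real \<Rightarrow> real \<Rightarrow> (real \<times> real) \<times> real \<Rightarrow> complex" where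
  "poisson_symbol e R r = complex_of_real (abs_weight e R (fst r) * exp (- (fst (fst r) * \<bar>snd r\<bar>)))"

lemma abs_weight_measurable[measurable]: "abs_weight e R \<in> borel_measurable borel"
  unfolding abs_weight_def[abs_def] by measurable

lemma poisson_weight_nonneg: "e > 0 \<Longrightarrow> poisson_weight e R p v \<ge> 0"
  by (auto simp: poisson_weight_def abs_weight_def indicator_def poisson_nonneg)

lemma integrable_window_decay:
  fixes c :: "(real \<times> real) \<times> real \<Rightarrow> complex"
  assumes [measurable]: "c \<in> borel_measurable borel"
    and b: "\<And>t \<xi> \<eta>. cmod (c ((t, \<xi>), \<eta>)) \<le> D * ((indicator {e..R} t * decay \<xi>) * decay \<eta>)"
  shows "integrable lborel c"
proof (rule Bochner_Integration.integrable_bound)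
  have "integrable lborel (indicator {e..R} :: real \<Rightarrow> real)"
    by (rule integrable_real_indicator) (auto simp: emeasure_lborel_Icc_eq)
  then have "integrable lborel (\<lambda>r::(real \<times> real) \<times> real. (indicator {e..R} (fst (fst r)) * decay (snd (fst r))) * decay (snd r))"
    by (intro integrable_tensor[of "\<lambda>p. indicator {e..R} (fst p) * decay (snd p)"] integrable_tensor[of "indicator {e..R}"] integrable_decay)
  then show "integrable lborel (\<lambda>r::(real \<times> real) \<times> real. D * ((indicator {e..R} (fst (fst r)) * decay (snd (fst r))) * decay (snd r)))"
    by simp
  show "AE r in lborel. norm (c r) \<le> norm (D * ((indicator {e..R} (fst (fst r)) * decay (snd (fst r))) * decay (snd r)))"
    by (intro AE_I2, clarsimp) (metis b abs_ge_self order_trans)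
qed simp

lemma poisson_symbol_measurable[measurable]: "poisson_symbol e R \<in> borel_measurable borel"
  unfolding poisson_symbol_def[abs_def] by measurable

lemma integrable_poisson_symbol:
  assumes e: "e > 0"
  shows "integrable lborel (poisson_symbol e R)"
proof -
  obtain D where D: "D > 0" "\<And>x. (1 + \<bar>x\<bar> + x\<^sup>2) * exp (- (e * \<bar>x\<bar>)) \<le> D * decay x" using exp_le_decay[OF e] by metis
  show ?thesis
  proof (rule integrable_window_decay[where D = "D * D"])
    fix t \<xi> \<eta> :: real
    show "cmod (poisson_symbol e R ((t, \<xi>), \<eta>)) \<le> D * D * ((indicator {e..R} t * decay \<xi>) * decay \<eta>)"
    proof (cases "t \<in> {e..R}")
      case True
      have le: "exp (- (t * \<bar>x\<bar>)) \<le> exp (- (e * \<bar>x\<bar>))" for x using True by (simp add: mult_right_mono)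
      have "\<bar>\<xi>\<bar> * exp (- (t * \<bar>\<xi>\<bar>)) \<le> (1 + \<bar>\<xi>\<bar> + \<xi>\<^sup>2) * exp (- (e * \<bar>\<xi>\<bar>))" by (intro mult_mono le) auto
      also note D(2)
      finally have 1: "\<bar>\<xi>\<bar> * exp (- (t * \<bar>\<xi>\<bar>)) \<le> D * decay \<xi>" .
      have "1 * exp (- (t * \<bar>\<eta>\<bar>)) \<le> (1 + \<bar>\<eta>\<bar> + \<eta>\<^sup>2) * exp (- (e * \<bar>\<eta>\<bar>))" by (intro mult_mono le) auto
      also note D(2)
      finally have 2: "exp (- (t * \<bar>\<eta>\<bar>)) \<le> D * decay \<eta>" by simp
      have "(\<bar>\<xi>\<bar> * exp (- (t * \<bar>\<xi>\<bar>))) * exp (- (t * \<bar>\<eta>\<bar>)) \<le> (D * decay \<xi>) * (D * decay \<eta>)"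
        by (intro mult_mono 1 2) (use D in auto)
      then show ?thesis using True by (simp add: poisson_symbol_def abs_weight_def norm_mult mult_ac flip: of_real_mult)
    qed (simp add: poisson_symbol_def abs_weight_def)
  qed measurable
qed

lemma partial_ft_poisson_symbol:
  assumes e: "e > 0"
  shows "partial_ft (poisson_symbol e R) p v = complex_of_real (poisson_weight e R p v)"
proof (cases "fst p \<in> {e..R}")
  case True
  then have t: "fst p > 0" using e by auto
  have "partial_ft (poisson_symbol e R) p v =
     (LINT \<eta>|lborel. complex_of_real (abs_weight e R p) * (complex_of_real (exp (- (fst p * \<bar>\<eta>\<bar>))) * wave (v * \<eta>)))"
    unfolding partial_ft_def poisson_symbol_def by (simp add: mult_ac)
  also have "\<dots> = complex_of_real (abs_weight e R p) * complex_of_real (poisson (fst p) v)"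
    unfolding fourier_exp_abs[OF t, symmetric] by (rule integral_mult_right_zero)
  finally show ?thesis by (simp add: poisson_weight_def)
qed (simp add: partial_ft_def poisson_symbol_def poisson_weight_def abs_weight_def)

lemma integrable_window:
  fixes f :: "real \<Rightarrow> real"
  assumes "\<And>t. isCont f t"
  shows "integrable lborel (\<lambda>t. indicator {e..R} t * f t)"
  using borel_integrable_atLeastAtMost[of e R f] assms by (simp add: mult.commute)

lemma window_FTC:
  fixes F f :: "real \<Rightarrow> real"
  assumes "e \<le> R" "\<And>t. (F has_real_derivative f t) (at t)" "\<And>t. isCont f t"
  shows "(LINT t|lborel. indicator {e..R} t * f t) = F R - F e"
  using integral_FTC_Icc_real[of e R F f] assms by (simp add: mult.commute)

text \<open>The two symbols add up to \<open>- d/dt e^{-t(|\<xi>|+|\<eta>|)}\<close>.\<close>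

lemma poisson_symbol_telescope:
  assumes "e \<le> R"
  shows "(LINT t|lborel. poisson_symbol e R ((t, \<xi>), \<eta>)) + (LINT t|lborel. poisson_symbol e R ((t, \<eta>), \<xi>))
    = complex_of_real (exp (- (e * \<bar>\<xi>\<bar>)) * exp (- (e * \<bar>\<eta>\<bar>))) - complex_of_real (exp (- (R * \<bar>\<xi>\<bar>)) * exp (- (R * \<bar>\<eta>\<bar>)))"
proof -
  let ?s = "\<bar>\<xi>\<bar> + \<bar>\<eta>\<bar>"
  have i: "integrable lborel (\<lambda>t. indicator {e..R} t * (a * exp (- (t * ?s))))" for a :: real
    by (intro integrable_window continuous_intros)
  have eq: "poisson_symbol e R ((t, x), y) = complex_of_real (indicator {e..R} t * (\<bar>x\<bar> * exp (- (t * (\<bar>x\<bar> + \<bar>y\<bar>)))))" for t x y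
  proof -
    have "exp (- (t * (\<bar>x\<bar> + \<bar>y\<bar>))) = exp (- (t * \<bar>x\<bar>)) * exp (- (t * \<bar>y\<bar>))"
      by (simp add: distrib_left flip: exp_add)
    then show ?thesis by (simp add: poisson_symbol_def abs_weight_def)
  qed
  have "(LINT t|lborel. indicator {e..R} t * (\<bar>\<xi>\<bar> * exp (- (t * ?s)))) + (LINT t|lborel. indicator {e..R} t * (\<bar>\<eta>\<bar> * exp (- (t * ?s))))
    = (LINT t|lborel. indicator {e..R} t * (\<bar>\<xi>\<bar> * exp (- (t * ?s))) + indicator {e..R} t * (\<bar>\<eta>\<bar> * exp (- (t * ?s))))"
    by (rule Bochner_Integration.integral_add[OF i i, symmetric])
  also have "\<dots> = (LINT t|lborel. indicator {e..R} t * (?s * exp (- (t * ?s))))"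
    by (simp add: algebra_simps)
  also have "\<dots> = - exp (- (R * ?s)) - (- exp (- (e * ?s)))"
    by (rule window_FTC[OF assms]) (auto intro!: derivative_eq_intros continuous_intros simp: algebra_simps)
  finally have "(LINT t|lborel. indicator {e..R} t * (\<bar>\<xi>\<bar> * exp (- (t * ?s)))) + (LINT t|lborel. indicator {e..R} t * (\<bar>\<eta>\<bar> * exp (- (t * ?s))))
    = exp (- (e * \<bar>\<xi>\<bar>)) * exp (- (e * \<bar>\<eta>\<bar>)) - exp (- (R * \<bar>\<xi>\<bar>)) * exp (- (R * \<bar>\<eta>\<bar>))"
    by (simp add: distrib_left flip: exp_add)
  then show ?thesis
    unfolding eq add.commute[of "\<bar>\<eta>\<bar>" "\<bar>\<xi>\<bar>"] Bochner_Integration.integral_complex_of_real by (simp only: of_real_add[symmetric] of_real_diff[symmetric])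
qed

definition poisson_form where
  "poisson_form e R F1 F2 F3 F4 = slice_form F1 F2 F3 F4 (\<lambda>p v. complex_of_real (poisson_weight e R p v))"

lemma integrable_diag_exp:
  assumes adm: "admissible F1" "admissible F2" "admissible F3" "admissible F4" and t: "t > 0"
  shows "integrable lborel (\<lambda>s. diag_ft F1 F2 F3 F4 s * complex_of_real (exp (- (t * \<bar>fst s\<bar>)) * exp (- (t * \<bar>snd s\<bar>))))"
proof -
  obtain B where B: "\<And>p. cmod (diag_ft F1 F2 F3 F4 p) \<le> B" using diag_ft_bounded by metis
  have [measurable]: "diag_ft F1 F2 F3 F4 \<in> borel_measurable borel" by (rule diag_ft_measurable[OF adm])
  have e: "integrable lborel (\<lambda>x::real. exp (- (t * \<bar>x\<bar>)))" using integrable_exp_abs[OF t] by simp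
  show ?thesis
  proof (rule Bochner_Integration.integrable_bound)
    show "integrable lborel (\<lambda>s::real \<times> real. B * (exp (- (t * \<bar>fst s\<bar>)) * exp (- (t * \<bar>snd s\<bar>))))"
      using integrable_tensor[OF e e] by simp
    have "B \<ge> 0" using B[of "(0,0)"] norm_ge_zero order_trans by blast
    then show "AE s in lborel. norm (diag_ft F1 F2 F3 F4 s * complex_of_real (exp (- (t * \<bar>fst s\<bar>)) * exp (- (t * \<bar>snd s\<bar>))))
      \<le> norm (B * (exp (- (t * \<bar>fst s\<bar>)) * exp (- (t * \<bar>snd s\<bar>))))"
      using B by (intro AE_I2) (auto simp: norm_mult intro!: mult_right_mono)
  qed measurable
qed

text \<open>The key identity: neither form on the left has an obvious bound, but their sum is a difference
of two averages.\<close>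

lemma poisson_form_telescope:
  assumes adm: "admissible F1" "admissible F2" "admissible F3" "admissible F4" and e: "0 < e" "e \<le> R"
  shows "poisson_form e R F1 F2 F3 F4 + poisson_form e R (flip F1) (flip F4) (flip F3) (flip F2)
    = poisson_mean F1 F2 F3 F4 e - poisson_mean F1 F2 F3 F4 R"
proof -
  have R: "R > 0" using e by simp
  note i = integrable_poisson_symbol[OF e(1), of R]
  have "poisson_form e R F1 F2 F3 F4 + poisson_form e R (flip F1) (flip F4) (flip F3) (flip F2)
    = (LINT s|lborel. diag_ft F1 F2 F3 F4 s * ((LINT t|lborel. poisson_symbol e R ((t, fst s), snd s)) + (LINT t|lborel. poisson_symbol e R ((t, snd s), fst s))))"
    unfolding symmetric_form_representation[OF adm i i]
    by (simp add: poisson_form_def partial_ft_poisson_symbol[OF e(1), abs_def])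
  also have "\<dots> = poisson_mean F1 F2 F3 F4 e - poisson_mean F1 F2 F3 F4 R"
    unfolding poisson_symbol_telescope[OF e(2)] right_diff_distrib poisson_mean_def
    by (rule Bochner_Integration.integral_diff[OF integrable_diag_exp[OF adm e(1)] integrable_diag_exp[OF adm R]])
  finally show ?thesis .
qed

definition square_form where
  "square_form e R F G = (LINT r|lborel. (cmod (slice_ft F G (snd (fst r)) (snd r)))\<^sup>2 *
      poisson_weight e R (fst r) (fst (snd r) - snd (snd r)))"

lemma square_form_nonneg: "e > 0 \<Longrightarrow> square_form e R F G \<ge> 0"
  unfolding square_form_def by (intro integral_nonneg_AE AE_I2 mult_nonneg_nonneg poisson_weight_nonneg) auto

lemma slice_prod_self: "slice_prod F (conjg F) (conjg G) G \<xi> q = complex_of_real ((cmod (slice_ft F G \<xi> q))\<^sup>2)"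
  unfolding slice_prod_def conjg_conjg by (rule complex_norm_square[symmetric])

text \<open>For these functions \<open>u = w\<close>, so the form is a square.\<close>

lemma poisson_form_self: "poisson_form e R F (conjg F) (conjg G) G = complex_of_real (square_form e R F G)"
  unfolding poisson_form_def slice_form_def square_form_def slice_prod_self
  by (simp only: of_real_mult[symmetric] Bochner_Integration.integral_complex_of_real)

lemma integrable_square_form:
  assumes adm: "admissible F" "admissible G" and e: "e > 0"
  shows "integrable lborel (\<lambda>r. (cmod (slice_ft F G (snd (fst r)) (snd r)))\<^sup>2 *
      poisson_weight e R (fst r) (fst (snd r) - snd (snd r)))"
proof -
  have "integrable lborel (\<lambda>r. slice_prod F (conjg F) (conjg G) G (snd (fst r)) (snd r) *
      partial_ft (poisson_symbol e R) (fst r) (fst (snd r) - snd (snd r)))"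
    by (intro integrable_slice_form admissible_conjg integrable_poisson_symbol adm e)
  then have "integrable lborel (\<lambda>r. complex_of_real ((cmod (slice_ft F G (snd (fst r)) (snd r)))\<^sup>2 *
      poisson_weight e R (fst r) (fst (snd r) - snd (snd r))))"
    unfolding partial_ft_poisson_symbol[OF e] slice_prod_self of_real_mult .
  then show ?thesis unfolding complex_of_real_integrable_eq .
qed

text \<open>Splitting the kernel bound as \<open>\<omega> = \<omega>^{1/2} \<omega>^{1/2}\<close> separates \<open>F1, F4\<close> (in \<open>u\<close>) from
\<open>F2, F3\<close> (in \<open>w\<close>).\<close>

lemma slice_form_Cauchy_Schwarz:
  assumes adm: "admissible F1" "admissible F2" "admissible F3" "admissible F4" and e: "e > 0"
    and k: "\<And>p v. cmod (k p v) \<le> D * poisson_weight e R p v" and D: "D \<ge> 0"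
  shows "cmod (slice_form F1 F2 F3 F4 k) \<le> D * (sqrt (square_form e R F1 F4) * sqrt (square_form e R (conjg F2) (conjg F3)))"
proof -
  let ?w = "\<lambda>r::(real \<times> real) \<times> (real \<times> real). poisson_weight e R (fst r) (fst (snd r) - snd (snd r))"
  let ?u = "\<lambda>r::(real \<times> real) \<times> (real \<times> real). cmod (slice_ft F1 F4 (snd (fst r)) (snd r))"
  let ?v = "\<lambda>r::(real \<times> real) \<times> (real \<times> real). cmod (slice_ft (conjg F2) (conjg F3) (snd (fst r)) (snd r))"
  have w: "?w r \<ge> 0" for r by (rule poisson_weight_nonneg[OF e])
  have [measurable]: "?w \<in> borel_measurable borel"
    unfolding poisson_weight_def
    using measurable_compose[OF _ borel_measurable_poisson, of "\<lambda>r::(real \<times> real) \<times> (real \<times> real). (fst (fst r), fst (snd r) - snd (snd r))" borel]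
    by simp
  have [measurable]: "?u \<in> borel_measurable borel" "?v \<in> borel_measurable borel"
    using measurable_compose[OF _ slice_ft_measurable[OF adm(1,4)], of "\<lambda>r::(real \<times> real) \<times> (real \<times> real). (snd (fst r), snd r)" borel]
      measurable_compose[OF _ slice_ft_measurable[OF admissible_conjg[OF adm(2)] admissible_conjg[OF adm(3)]], of "\<lambda>r::(real \<times> real) \<times> (real \<times> real). (snd (fst r), snd r)" borel]
    by simp_all
  have sq: "(sqrt (?w r) * ?u r)\<^sup>2 = (?u r)\<^sup>2 * ?w r" "(sqrt (?w r) * ?v r)\<^sup>2 = (?v r)\<^sup>2 * ?w r" for r
    using w[of r] by (simp_all add: power_mult_distrib)
  have i: "integrable lborel (\<lambda>r. (sqrt (?w r) * ?u r)\<^sup>2)" "integrable lborel (\<lambda>r. (sqrt (?w r) * ?v r)\<^sup>2)"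
    unfolding sq by (intro integrable_square_form admissible_conjg adm e)+
  have m: "(\<lambda>r. sqrt (?w r) * ?u r) \<in> borel_measurable lborel" "(\<lambda>r. sqrt (?w r) * ?v r) \<in> borel_measurable lborel" by measurable
  have nn: "sqrt (?w r) * ?u r \<ge> 0" "sqrt (?w r) * ?v r \<ge> 0" for r using w[of r] by auto
  note CS = Cauchy_Schwarz_integral[OF m i nn]
  have "cmod (slice_form F1 F2 F3 F4 k) \<le> (LINT r|lborel. cmod (slice_prod F1 F2 F3 F4 (snd (fst r)) (snd r) * k (fst r) (fst (snd r) - snd (snd r))))"
    unfolding slice_form_def by (rule integral_norm_bound)
  also have "\<dots> \<le> (LINT r|lborel. D * ((sqrt (?w r) * ?u r) * (sqrt (?w r) * ?v r)))"
  proof (rule integral_mono')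
    show "integrable lborel (\<lambda>r. D * ((sqrt (?w r) * ?u r) * (sqrt (?w r) * ?v r)))" using CS(1) by simp
    fix r :: "(real \<times> real) \<times> (real \<times> real)"
    have "cmod (slice_prod F1 F2 F3 F4 (snd (fst r)) (snd r) * k (fst r) (fst (snd r) - snd (snd r))) = ?u r * ?v r * cmod (k (fst r) (fst (snd r) - snd (snd r)))"
      by (simp add: slice_prod_def norm_mult)
    also have "\<dots> \<le> ?u r * ?v r * (D * ?w r)" by (intro mult_left_mono k) auto
    also have "?w r = sqrt (?w r) * sqrt (?w r)" using w[of r] by simp
    finally show "cmod (slice_prod F1 F2 F3 F4 (snd (fst r)) (snd r) * k (fst r) (fst (snd r) - snd (snd r))) \<le> D * ((sqrt (?w r) * ?u r) * (sqrt (?w r) * ?v r))"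
      by (simp only: mult_ac)
    show "0 \<le> D * ((sqrt (?w r) * ?u r) * (sqrt (?w r) * ?v r))"
      by (intro mult_nonneg_nonneg[OF D] mult_nonneg_nonneg[OF nn])
  qed
  also have "\<dots> = D * (LINT r|lborel. (sqrt (?w r) * ?u r) * (sqrt (?w r) * ?v r))" by (rule integral_mult_right_zero)
  also have "\<dots> \<le> D * (sqrt (square_form e R F1 F4) * sqrt (square_form e R (conjg F2) (conjg F3)))"
    using CS(2) D unfolding sq square_form_def by (intro mult_left_mono)
  finally show ?thesis .
qed

lemma Lp_norm_flip: 
  assumes "admissible F"
  shows "Lp_norm 4 (flip F) = Lp_norm 4 F"
proof -
  have [measurable]: "F \<in> borel_measurable borel" by (rule admissible_measurable[OF assms])
  show ?thesis unfolding Lp_norm_def flip_def[abs_def]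
    using lborel_integral_swap[of "\<lambda>p. cmod (F p) powr 4"] by simp
qed

lemma Lp_norm_conjg: "Lp_norm 4 (conjg F) = Lp_norm 4 F"
  by (simp add: Lp_norm_def conjg_def)

text \<open>For \<open>(F, cnj F, F, cnj F)\<close> both forms in the telescoping identity are squares, so each is at most
their sum.\<close>

lemma square_form_diag_bound:
  assumes F: "admissible F" and e: "0 < e" "e \<le> R"
  shows "square_form e R F (conjg F) \<le> 2 * Lp_norm 4 F ^ 4"
proof -
  have R: "R > 0" using e by simp
  note a = F admissible_conjg[OF F]
  have S: "poisson_form e R F (conjg F) F (conjg F) + poisson_form e R (flip F) (conjg (flip F)) (flip F) (conjg (flip F))
     = poisson_mean F (conjg F) F (conjg F) e - poisson_mean F (conjg F) F (conjg F) R"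
    using poisson_form_telescope[OF a a e] by (simp add: flip_conjg)
  have "poisson_form e R F (conjg F) F (conjg F) + poisson_form e R (flip F) (conjg (flip F)) (flip F) (conjg (flip F))
     = complex_of_real (square_form e R F (conjg F) + square_form e R (flip F) (conjg (flip F)))"
    using poisson_form_self[of e R F "conjg F"] poisson_form_self[of e R "flip F" "conjg (flip F)"] by simp
  then have "square_form e R F (conjg F) + square_form e R (flip F) (conjg (flip F))
     \<le> cmod (poisson_form e R F (conjg F) F (conjg F) + poisson_form e R (flip F) (conjg (flip F)) (flip F) (conjg (flip F)))"
    by (simp only: norm_of_real abs_ge_self)
  also have "\<dots> \<le> cmod (poisson_mean F (conjg F) F (conjg F) e) + cmod (poisson_mean F (conjg F) F (conjg F) R)"
    unfolding S by (rule norm_triangle_ineq4)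
  also have "\<dots> \<le> Lp_norm 4 F ^ 4 + Lp_norm 4 F ^ 4"
    using poisson_mean_bound[OF a a e(1)] poisson_mean_bound[OF a a R]
    by (simp add: Lp_norm_conjg power4_eq_xxxx)
  finally show ?thesis using square_form_nonneg[OF e(1), of R "flip F" "conjg (flip F)"] by linarith
qed

text \<open>For \<open>(F, cnj F, cnj G, G)\<close> the first form in the telescoping identity is \<open>square_form\<close> of \<open>F\<close> and \<open>G\<close>.
The mirrored form has no sign, but after the flip \<open>F\<close> is paired with \<open>cnj F\<close> and \<open>G\<close> with \<open>cnj G\<close>, so
Cauchy-Schwarz reduces it to \<open>square_form_diag_bound\<close>.\<close>

lemma square_form_bound:
  assumes F: "admissible F" and G: "admissible G" and e: "0 < e" "e \<le> R"
  shows "square_form e R F G \<le> 4 * (Lp_norm 4 F ^ 2 * Lp_norm 4 G ^ 2)"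
proof -
  have R: "R > 0" using e by simp
  note a = F admissible_conjg[OF F] admissible_conjg[OF G] G
  let ?T = "poisson_form e R (flip F) (flip G) (conjg (flip G)) (conjg (flip F))"
  let ?N = "Lp_norm 4 F ^ 2 * Lp_norm 4 G ^ 2"
  have S: "complex_of_real (square_form e R F G) + ?T = poisson_mean F (conjg F) (conjg G) G e - poisson_mean F (conjg F) (conjg G) G R"
    using poisson_form_telescope[OF a e] by (simp add: flip_conjg poisson_form_self)
  have "cmod ?T \<le> 1 * (sqrt (square_form e R (flip F) (conjg (flip F))) * sqrt (square_form e R (conjg (flip G)) (conjg (conjg (flip G)))))"
    unfolding poisson_form_def
    by (rule slice_form_Cauchy_Schwarz) (use F G e in \<open>auto intro!: admissible_conjg admissible_flip simp: poisson_weight_nonneg\<close>)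
  also have "\<dots> \<le> 1 * (sqrt (2 * Lp_norm 4 (flip F) ^ 4) * sqrt (2 * Lp_norm 4 (conjg (flip G)) ^ 4))"
    using e F G by (intro mult_left_mono mult_mono real_sqrt_le_mono square_form_diag_bound admissible_conjg admissible_flip)
      (auto simp: square_form_nonneg Lp_norm_nonneg)
  also have "\<dots> = 2 * ?N"
  proof -
    have "sqrt (x ^ 4) = x\<^sup>2" for x :: real by (rule real_sqrt_unique) auto
    then show ?thesis by (simp add: Lp_norm_conjg Lp_norm_flip F G real_sqrt_mult)
  qed
  finally have T: "cmod ?T \<le> 2 * ?N" .
  have "square_form e R F G \<le> cmod (complex_of_real (square_form e R F G))" by simp
  also have "\<dots> = cmod ((complex_of_real (square_form e R F G) + ?T) - ?T)" by simp
  also have "\<dots> \<le> cmod (poisson_mean F (conjg F) (conjg G) G e - poisson_mean F (conjg F) (conjg G) G R) + cmod ?T"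
    unfolding S by (rule norm_triangle_ineq4)
  also have "\<dots> \<le> cmod (poisson_mean F (conjg F) (conjg G) G e) + cmod (poisson_mean F (conjg F) (conjg G) G R) + cmod ?T"
    by (intro add_right_mono norm_triangle_ineq4)
  also have "\<dots> \<le> ?N + ?N + 2 * ?N"
    using poisson_mean_bound[OF a e(1)] poisson_mean_bound[OF a R] T
    by (intro add_mono) (simp_all add: Lp_norm_conjg power2_eq_square mult_ac)
  finally show ?thesis by simp
qed

text \<open>What remains to be checked for a given symbol is only a pointwise bound of its partial Fourier
transform by the model kernel.\<close>

lemma slice_form_bound:
  assumes adm: "admissible F1" "admissible F2" "admissible F3" "admissible F4" and e: "0 < e" "e \<le> R"
    and k: "\<And>p v. cmod (k p v) \<le> D * poisson_weight e R p v" and D: "D \<ge> 0"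
  shows "cmod (slice_form F1 F2 F3 F4 k) \<le> 4 * D * (Lp_norm 4 F1 * Lp_norm 4 F2 * Lp_norm 4 F3 * Lp_norm 4 F4)"
proof -
  have sq: "sqrt (4 * (x\<^sup>2 * y\<^sup>2)) = 2 * (x * y)" if "x \<ge> 0" "y \<ge> 0" for x y :: real
    using that by (simp add: real_sqrt_mult)
  have "sqrt (square_form e R F1 F4) \<le> 2 * (Lp_norm 4 F1 * Lp_norm 4 F4)"
    using real_sqrt_le_mono[OF square_form_bound[OF adm(1,4) e]] by (simp add: sq Lp_norm_nonneg)
  moreover have "sqrt (square_form e R (conjg F2) (conjg F3)) \<le> 2 * (Lp_norm 4 F2 * Lp_norm 4 F3)"
    using real_sqrt_le_mono[OF square_form_bound[OF admissible_conjg[OF adm(2)] admissible_conjg[OF adm(3)] e]] 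
    by (simp add: sq Lp_norm_nonneg Lp_norm_conjg)
  ultimately have "sqrt (square_form e R F1 F4) * sqrt (square_form e R (conjg F2) (conjg F3))
     \<le> (2 * (Lp_norm 4 F1 * Lp_norm 4 F4)) * (2 * (Lp_norm 4 F2 * Lp_norm 4 F3))"
    using e by (intro mult_mono) (auto simp: Lp_norm_nonneg square_form_nonneg)
  with slice_form_Cauchy_Schwarz[OF adm e(1) k D] D
  have "cmod (slice_form F1 F2 F3 F4 k) \<le> D * ((2 * (Lp_norm 4 F1 * Lp_norm 4 F4)) * (2 * (Lp_norm 4 F2 * Lp_norm 4 F3)))"
    by (meson mult_left_mono order_trans)
  then show ?thesis by (simp add: mult_ac)
qed

section \<open>Integration by parts in the second frequency\<close>

lemma gauss_le_decay_sharp: "(7 + 4 * y\<^sup>2) * exp (- (y\<^sup>2)) \<le> 14 * decay (y::real)"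
proof -
  have "(7 + 4 * y\<^sup>2) * (1 + y\<^sup>2) \<le> 14 * (1 + y\<^sup>2 + (y\<^sup>2)\<^sup>2 / 2)"
  proof -
    have "(7 + 4 * s) * (1 + s) \<le> 14 * (1 + s + s\<^sup>2 / 2)" if "s \<ge> 0" for s :: real
      using that zero_le_power2[of s] by (simp add: algebra_simps power2_eq_square)
    from this[OF zero_le_power2] show ?thesis .
  qed
  also have "\<dots> \<le> 14 * exp (y\<^sup>2)" using exp_lower_Taylor_quadratic[of "y\<^sup>2"] by simp
  finally have "(7 + 4 * y\<^sup>2) * (1 + y\<^sup>2) * exp (- (y\<^sup>2)) \<le> 14 * exp (y\<^sup>2) * exp (- (y\<^sup>2))"
    by (rule mult_right_mono) simp
  also have "\<dots> = 14" by (simp flip: exp_add)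
  finally show ?thesis
    by (simp add: decay_def flip: divide_inverse) (subst pos_le_divide_eq, simp_all add: add_pos_nonneg mult_ac)
qed

lemma exp_neg_le_decay: "exp (- (y\<^sup>2)) \<le> decay (y::real)"
proof -
  have "decay y = 1 / (1 + y\<^sup>2)" by (simp add: decay_def divide_inverse)
  moreover have "exp (- (y\<^sup>2)) = 1 / exp (y\<^sup>2)" by (simp add: exp_minus divide_inverse)
  ultimately show ?thesis using exp_ge_add_one_self[of "y\<^sup>2"] by (simp add: frac_le add_pos_nonneg)
qed

lemma wave_has_vector_derivative:
  "((\<lambda>x. wave (x * v)) has_vector_derivative (- (2 * pi * v) * \<i>) * wave (x * v)) (at x)"
proof -
  have eq: "wave (x * v) = exp ((- (2 * pi * v) * \<i>) * complex_of_real x)" for x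
    by (simp add: wave_def cis_conv_exp mult_ac)
  have "((\<lambda>z. exp ((- (2 * pi * v) * \<i>) * z)) has_field_derivative (- (2 * pi * v) * \<i>) * exp ((- (2 * pi * v) * \<i>) * complex_of_real x)) (at (complex_of_real x))"
    by (auto intro!: derivative_eq_intros)
  then show ?thesis unfolding eq by (rule has_vector_derivative_real_field)
qed

text \<open>With \<open>h(x) = g(x) e^{-t^2 x^2}\<close>, two integrations by parts give
\<open>\<integral> (h - h'' / t^2) e^{-2 \<pi> i x v} = (1 + (2 \<pi> v / t)^2) \<integral> h e^{-2 \<pi> i x v}\<close>. The integrand on the left
is at most \<open>A\<close> times \<open>14 / (1 + t^2 x^2) + 1 / (t^2 (a^2 + x^2))\<close>: the first term collects \<open>g\<close> and
\<open>g'\<close>, where the factor \<open>x\<close> from differentiating the Gaussian compensates the growth of \<open>g'\<close> at small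
arguments; the second term is the contribution of \<open>g''\<close>. The result is a multiple of the Poisson
kernel.\<close>

lemma gauss_multiplier_ft_bound:
  fixes g g1 g2 :: "real \<Rightarrow> complex"
  assumes d1: "\<And>x. (g has_vector_derivative g1 x) (at x)" and d2: "\<And>x. (g1 has_vector_derivative g2 x) (at x)"
    and c2: "continuous_on UNIV g2"
    and b0: "\<And>x. cmod (g x) \<le> A" and b1: "\<And>x. cmod (g1 x) * (a + \<bar>x\<bar>) \<le> A" and b2: "\<And>x. cmod (g2 x) * (a + \<bar>x\<bar>)\<^sup>2 \<le> A"
    and a: "a > 0" and t: "t > 0"
  shows "cmod (LINT x|lborel. g x * complex_of_real (exp (- (t\<^sup>2 * x\<^sup>2))) * wave (x * v))
    \<le> A * pi * (14 / t + 1 / (t\<^sup>2 * a)) * decay (2 * pi / t * v)"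
proof -
  define E where "E = (\<lambda>x::real. exp (- (t\<^sup>2 * x\<^sup>2)))"
  define h where "h = (\<lambda>x. g x * complex_of_real (E x))"
  define h1 where "h1 = (\<lambda>x. g1 x * complex_of_real (E x) - g x * complex_of_real (2 * t\<^sup>2 * x * E x))"
  define h2 where "h2 = (\<lambda>x. g2 x * complex_of_real (E x) - g1 x * complex_of_real (4 * t\<^sup>2 * x * E x)
      + g x * complex_of_real ((4 * t ^ 4 * x\<^sup>2 - 2 * t\<^sup>2) * E x))"
  define \<kappa> where "\<kappa> = - complex_of_real (2 * pi * v) * \<i>"
  define w where "w = (\<lambda>x. wave (x * v))"
  have A: "A \<ge> 0" using b0[of 0] norm_ge_zero order_trans by blast
  have E0: "E x \<ge> 0" for x by (simp add: E_def)
  have E1: "E x \<le> 1" for x by (simp add: E_def)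
  have dE: "((\<lambda>x. complex_of_real (E x)) has_vector_derivative - complex_of_real (2 * t\<^sup>2 * x * E x)) (at x)" for x
    unfolding of_real_minus[symmetric] E_def
    by (intro has_vector_derivative_of_real) (auto intro!: derivative_eq_intros simp flip: has_real_derivative_iff_has_vector_derivative)
  have dE2: "((\<lambda>x. complex_of_real (2 * t\<^sup>2 * x * E x)) has_vector_derivative - complex_of_real ((4 * t ^ 4 * x\<^sup>2 - 2 * t\<^sup>2) * E x)) (at x)" for x
    unfolding of_real_minus[symmetric] E_def
    by (intro has_vector_derivative_of_real)
      (auto intro!: derivative_eq_intros simp: algebra_simps power2_eq_square power4_eq_xxxx simp flip: has_real_derivative_iff_has_vector_derivative)
  have dh: "(h has_vector_derivative h1 x) (at x)" for x
    unfolding h_def h1_def using has_vector_derivative_mult[OF d1 dE, of x] by (simp add: algebra_simps)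
  have dh1: "(h1 has_vector_derivative h2 x) (at x)" for x
    unfolding h1_def h2_def
    using has_vector_derivative_diff[OF has_vector_derivative_mult[OF d2 dE] has_vector_derivative_mult[OF d1 dE2], of x]
    by (simp add: algebra_simps)
  have dw: "(w has_vector_derivative \<kappa> * w x) (at x)" for x
    unfolding w_def \<kappa>_def using wave_has_vector_derivative[of v x] by simp
  have nw: "cmod (w x) = 1" for x by (simp add: w_def)
  \<comment> \<open>Since \<open>w'' = \<kappa>^2 w\<close>, this \<open>F = h' w - h w'\<close> has derivative \<open>(h'' - \<kappa>^2 h) w\<close>: both integrations
    by parts are done at once.\<close>
  define F where "F = (\<lambda>x. h1 x * w x - \<kappa> * (h x * w x))"
  have dF: "(F has_vector_derivative (h2 x + complex_of_real ((2 * pi * v)\<^sup>2) * h x) * w x) (at x)" for x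
  proof -
    have "(F has_vector_derivative ((h1 x * (\<kappa> * w x) + h2 x * w x) - \<kappa> * (h x * (\<kappa> * w x) + h1 x * w x))) (at x)"
      unfolding F_def
      by (intro has_vector_derivative_diff has_vector_derivative_mult dh1 dw dh has_vector_derivative_mult_right)
    moreover have "\<kappa> * \<kappa> = - complex_of_real ((2 * pi * v)\<^sup>2)" by (simp add: \<kappa>_def power2_eq_square)
    then have "(h1 x * (\<kappa> * w x) + h2 x * w x) - \<kappa> * (h x * (\<kappa> * w x) + h1 x * w x) = (h2 x + complex_of_real ((2 * pi * v)\<^sup>2) * h x) * w x"
      by algebra
    ultimately show ?thesis by simp
  qed
  have cg: "continuous_on UNIV g" "continuous_on UNIV g1"
    
    by (intro continuous_at_imp_continuous_on ballI has_vector_derivative_continuous[OF d1] has_vector_derivative_continuous[OF d2])+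
  have ch: "continuous_on UNIV h" "continuous_on UNIV h2"
    unfolding h_def h2_def E_def by (intro continuous_intros cg c2)+
  have cw: "continuous_on UNIV w" by (intro continuous_at_imp_continuous_on ballI has_vector_derivative_continuous[OF dw])
  have [measurable]: "h \<in> borel_measurable borel" "h2 \<in> borel_measurable borel" "w \<in> borel_measurable borel"
    using ch cw by (auto intro: borel_measurable_continuous_onI)
  define u where "u = (\<lambda>x. h x - complex_of_real (1 / t\<^sup>2) * h2 x)"
  define U where "U = (\<lambda>x. A * (14 * decay (t * x) + 1 / (t\<^sup>2 * a\<^sup>2) * decay (1 / a * x)))"
  have uU: "cmod (u x) \<le> U x" for x
  proof -
    have ax: "a + \<bar>x\<bar> > 0" using a by simp
    have e: "u x = g x * complex_of_real ((3 - 4 * (t * x)\<^sup>2) * E x) + g1 x * complex_of_real (4 * x * E x) - g2 x * complex_of_real (1 / t\<^sup>2 * E x)"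
    proof -
      have t0: "complex_of_real t \<noteq> 0" using t by simp
      show ?thesis unfolding u_def h_def h2_def using t0 
        by (simp add: field_simps power2_eq_square power4_eq_xxxx)
    qed
    have "cmod (g x * complex_of_real ((3 - 4 * (t * x)\<^sup>2) * E x)) \<le> A * ((3 + 4 * (t * x)\<^sup>2) * E x)"
    proof -
      have "\<bar>3 - 4 * (t * x)\<^sup>2\<bar> \<le> 3 + 4 * (t * x)\<^sup>2" by (simp add: abs_le_iff)
      then have "\<bar>3 - 4 * (t * x)\<^sup>2\<bar> * E x \<le> (3 + 4 * (t * x)\<^sup>2) * E x" by (rule mult_right_mono[OF _ E0])
      then have "cmod (g x) * (\<bar>3 - 4 * (t * x)\<^sup>2\<bar> * E x) \<le> A * ((3 + 4 * (t * x)\<^sup>2) * E x)"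
        by (rule mult_mono[OF b0]) (use A E0[of x] in auto)
      then show ?thesis using E0[of x] by (simp add: norm_mult abs_mult del: of_real_mult of_real_diff)
    qed
    moreover have "cmod (g1 x * complex_of_real (4 * x * E x)) \<le> A * (4 * E x)"
    proof -
      have "cmod (g1 x) * \<bar>x\<bar> \<le> cmod (g1 x) * (a + \<bar>x\<bar>)" using a by (intro mult_left_mono) auto
      also have "\<dots> \<le> A" by (rule b1)
      finally have "(cmod (g1 x) * \<bar>x\<bar>) * (4 * E x) \<le> A * (4 * E x)" by (rule mult_right_mono) (simp add: E0)
      then show ?thesis using E0[of x] by (simp add: norm_mult abs_mult mult_ac del: of_real_mult)
    qed
    moreover have "cmod (g2 x * complex_of_real (1 / t\<^sup>2 * E x)) \<le> A * (1 / (t\<^sup>2 * a\<^sup>2) * decay (1 / a * x))"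
    proof -
      have "a\<^sup>2 + x\<^sup>2 \<le> (a + \<bar>x\<bar>)\<^sup>2" using a by (simp add: power2_sum)
      then have "cmod (g2 x) * (a\<^sup>2 + x\<^sup>2) \<le> cmod (g2 x) * (a + \<bar>x\<bar>)\<^sup>2" by (intro mult_left_mono) auto
      also have "\<dots> \<le> A" by (rule b2)
      finally have "cmod (g2 x) \<le> A / (a\<^sup>2 + x\<^sup>2)" using a by (simp add: pos_le_divide_eq add_pos_nonneg)
      also have "\<dots> = A * (1 / a\<^sup>2 * decay (1 / a * x))" using a by (simp add: decay_def divide_simps)
      finally have "cmod (g2 x) * (1 / t\<^sup>2 * E x) \<le> (A * (1 / a\<^sup>2 * decay (1 / a * x))) * (1 / t\<^sup>2 * 1)"
        by (intro mult_mono mult_left_mono E1) (use A E0[of x] in auto)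
      then show ?thesis using E0[of x] by (simp add: norm_mult norm_divide norm_power abs_mult mult_ac del: of_real_mult)
    qed
    ultimately have "cmod (u x) \<le> A * ((3 + 4 * (t * x)\<^sup>2) * E x) + A * (4 * E x) + A * (1 / (t\<^sup>2 * a\<^sup>2) * decay (1 / a * x))"
      unfolding e by (intro order_trans[OF norm_triangle_ineq4] add_mono order_trans[OF norm_triangle_ineq])
    also have "\<dots> = A * ((7 + 4 * (t * x)\<^sup>2) * exp (- ((t * x)\<^sup>2)) + 1 / (t\<^sup>2 * a\<^sup>2) * decay (1 / a * x))"
      by (simp add: E_def algebra_simps power_mult_distrib)
    also have "\<dots> \<le> U x" unfolding U_def by (intro mult_left_mono add_right_mono gauss_le_decay_sharp A)
    finally show ?thesis .
  qed
  have iU: "integrable lborel U" unfolding U_def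
    using integrable_decay_scaled[OF t] integrable_decay_scaled[of "1 / a"] a by simp
  have IU: "(LINT x|lborel. U x) = A * pi * (14 / t + 1 / (t\<^sup>2 * a))"
    unfolding U_def using integrable_decay_scaled[OF t] integrable_decay_scaled[of "1 / a"] a t
      integral_decay_scaled[OF t] integral_decay_scaled[of "1 / a"]
    by (simp add: field_simps power2_eq_square)
  have ih: "integrable lborel h"
  proof (rule Bochner_Integration.integrable_bound)
    show "integrable lborel (\<lambda>x. A * decay (t * x))" using integrable_decay_scaled[OF t] by simp
    have "cmod (h x) \<le> A * decay (t * x)" for x
      using exp_neg_le_decay[of "t * x"] b0[of x] A E0[of x] unfolding h_def E_def norm_mult
      by (intro mult_mono) (auto simp: power_mult_distrib)
    then show "AE x in lborel. norm (h x) \<le> norm (A * decay (t * x))" by (auto intro: order_trans[OF _ abs_ge_self])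
  qed measurable
  have iu: "integrable lborel u"
    by (rule Bochner_Integration.integrable_bound[OF iU]) (use uU in \<open>auto simp: u_def intro: order_trans[OF _ abs_ge_self]\<close>)
  have ih2: "integrable lborel h2"
  proof -
    have "h2 = (\<lambda>x. complex_of_real (t\<^sup>2) * (h x - u x))" using t by (simp add: u_def fun_eq_iff)
    then show ?thesis using ih iu by simp
  qed
  have iw: "integrable lborel (\<lambda>x. f x * w x)" if "integrable lborel f" for f
    unfolding w_def using integrable_mult_wave[OF that, of "\<lambda>x. x * v"] by simp
  have lim: "(F \<longlongrightarrow> 0) G" if "((\<lambda>x. (A / a + A * (2 * t\<^sup>2 * \<bar>x\<bar>) + cmod \<kappa> * A) * exp (- (t\<^sup>2 * x\<^sup>2))) \<longlongrightarrow> 0) G" for G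
  proof (rule Lim_null_comparison[OF _ that], rule always_eventually, rule allI)
    fix x
    have g1: "cmod (g1 x) \<le> A / a"
    proof -
      have "cmod (g1 x) * a \<le> cmod (g1 x) * (a + \<bar>x\<bar>)" by (intro mult_left_mono) auto
      also note b1
      finally show ?thesis using a by (simp add: pos_le_divide_eq)
    qed
    have "cmod (F x) \<le> cmod (h1 x) + cmod \<kappa> * cmod (h x)"
      unfolding F_def by (rule order_trans[OF norm_triangle_ineq4]) (simp add: norm_mult nw)
    also have "cmod (h1 x) \<le> cmod (g1 x) * E x + cmod (g x) * (2 * t\<^sup>2 * \<bar>x\<bar> * E x)"
      unfolding h1_def by (rule order_trans[OF norm_triangle_ineq4]) (use E0[of x] in \<open>simp add: norm_mult abs_mult del: of_real_mult\<close>)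
    also have "\<dots> \<le> A / a * E x + A * (2 * t\<^sup>2 * \<bar>x\<bar> * E x)"
      by (intro add_mono mult_right_mono g1 b0) (use E0[of x] in auto)
    also have "cmod \<kappa> * cmod (h x) \<le> cmod \<kappa> * (A * E x)"
      unfolding h_def using mult_right_mono[OF b0 E0, of x x] E0[of x] by (intro mult_left_mono) (simp_all add: norm_mult)
    finally show "cmod (F x) \<le> (A / a + A * (2 * t\<^sup>2 * \<bar>x\<bar>) + cmod \<kappa> * A) * exp (- (t\<^sup>2 * x\<^sup>2))"
      by (simp add: E_def algebra_simps)
  qed
  have "(LINT x|lborel. (h2 x + complex_of_real ((2 * pi * v)\<^sup>2) * h x) * w x) = 0"
  proof (rule integral_derivative_real_line[OF dF])
    show "continuous_on UNIV (\<lambda>x. (h2 x + complex_of_real ((2 * pi * v)\<^sup>2) * h x) * w x)"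
      by (intro continuous_intros ch cw)
    show "integrable lborel (\<lambda>x. (h2 x + complex_of_real ((2 * pi * v)\<^sup>2) * h x) * w x)"
      by (intro iw Bochner_Integration.integrable_add ih2 integrable_mult_right ih)
    show "(F \<longlongrightarrow> 0) at_top" by (rule lim) (use t in real_asymp)
    show "(F \<longlongrightarrow> 0) at_bot" by (rule lim) (use t in real_asymp)
  qed
  then have z: "(LINT x|lborel. h2 x * w x) = - complex_of_real ((2 * pi * v)\<^sup>2) * (LINT x|lborel. h x * w x)"
    using iw[OF ih] iw[OF ih2] by (simp add: distrib_right mult.assoc add_eq_0_iff2)
  have "(LINT x|lborel. u x * w x) = (LINT x|lborel. h x * w x) - complex_of_real (1 / t\<^sup>2) * (LINT x|lborel. h2 x * w x)"
    using iw[OF ih] iw[OF ih2] by (simp add: u_def left_diff_distrib mult.assoc)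
  also have "\<dots> = complex_of_real (1 + (2 * pi / t * v)\<^sup>2) * (LINT x|lborel. h x * w x)"
    unfolding z using t by (simp add: field_simps power2_eq_square)
  finally have "(1 + (2 * pi / t * v)\<^sup>2) * cmod (LINT x|lborel. h x * w x) = cmod (LINT x|lborel. u x * w x)"
    by (simp only: norm_mult norm_of_real) simp
  also have "\<dots> \<le> (LINT x|lborel. U x)"
  proof (rule order_trans[OF integral_norm_bound], rule integral_mono')
    show "cmod (u x * w x) \<le> U x" for x using uU[of x] by (simp add: norm_mult nw)
    show "0 \<le> U x" for x using uU[of x] norm_ge_zero order_trans by blast
  qed (rule iU)
  finally have "(1 + (2 * pi / t * v)\<^sup>2) * cmod (LINT x|lborel. h x * w x) \<le> A * pi * (14 / t + 1 / (t\<^sup>2 * a))" unfolding IU .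
  then have "cmod (LINT x|lborel. h x * w x) \<le> A * pi * (14 / t + 1 / (t\<^sup>2 * a)) / (1 + (2 * pi / t * v)\<^sup>2)"
    by (subst pos_le_divide_eq) (simp_all add: add_pos_nonneg mult.commute)
  then show ?thesis by (simp add: h_def E_def w_def decay_def divide_inverse)
qed

section \<open>General symbols\<close>

text \<open>The symbol estimates restricted to the lines \<open>\<xi> = const \<noteq> 0\<close>, which avoid the singularity at the
origin.\<close>

definition line_symbol :: "real \<Rightarrow> (real \<times> real \<Rightarrow> complex) \<Rightarrow> bool" where
  "line_symbol A m \<longleftrightarrow> (\<forall>\<xi>. \<xi> \<noteq> 0 \<longrightarrow> (\<exists>g1 g2.
     (\<forall>\<eta>. ((\<lambda>\<eta>. m (\<xi>, \<eta>)) has_vector_derivative g1 \<eta>) (at \<eta>)) \<and>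
     (\<forall>\<eta>. (g1 has_vector_derivative g2 \<eta>) (at \<eta>)) \<and> continuous_on UNIV g2 \<and>
     (\<forall>\<eta>. cmod (m (\<xi>, \<eta>)) \<le> A) \<and> (\<forall>\<eta>. cmod (g1 \<eta>) * (\<bar>\<xi>\<bar> + \<bar>\<eta>\<bar>) \<le> A) \<and>
     (\<forall>\<eta>. cmod (g2 \<eta>) * (\<bar>\<xi>\<bar> + \<bar>\<eta>\<bar>)\<^sup>2 \<le> A)))"

text \<open>The part of \<open>2 t (\<xi>^2 + \<eta>^2) e^{-t^2(\<xi>^2 + \<eta>^2)} m(\<xi>, \<eta>)\<close> that carries \<open>\<xi>^2\<close>, for
\<open>t \<in> [e, R]\<close>.\<close>

definition gauss_symbol :: "real \<Rightarrow> real \<Rightarrow> (real \<times> real \<Rightarrow> complex) \<Rightarrow> (real \<times> real) \<times> real \<Rightarrow> complex" where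
  "gauss_symbol e R m r = complex_of_real (indicator {e..R} (fst (fst r)) *
      (2 * fst (fst r) * (snd (fst r))\<^sup>2 * exp (- ((fst (fst r))\<^sup>2 * (snd (fst r))\<^sup>2)))) *
     (m (snd (fst r), snd r) * complex_of_real (exp (- ((fst (fst r))\<^sup>2 * (snd r)\<^sup>2))))"

text \<open>From \<open>14 s + 1 \<le> 14 e^s\<close> and \<open>2 s - s^2 \<le> 1\<close>; the constant is \<open>14 * 3 \<ge> 14 e\<close>.\<close>

lemma gauss_le_exp: 
  fixes s :: real
  assumes "s \<ge> 0"
  shows "(14 * s + 1) * exp (- (s\<^sup>2)) \<le> 42 * exp (- s)"
proof -
  have "0 \<le> (s - 1)\<^sup>2" by simp
  then have "- (s\<^sup>2) + s + s \<le> 1" by (simp add: power2_diff)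
  then have "exp (- (s\<^sup>2) + s + s) \<le> exp 1" by simp
  also have "\<dots> \<le> 3" by (rule exp_le)
  finally have 3: "exp (- (s\<^sup>2)) * exp s * exp s \<le> 3" by (simp only: exp_add)
  have "14 * s + 1 \<le> 14 * exp s" using exp_ge_add_one_self[of s] by linarith
  then have "(14 * s + 1) * (exp (- (s\<^sup>2)) * exp s) \<le> 14 * exp s * (exp (- (s\<^sup>2)) * exp s)"
    by (rule mult_right_mono) simp
  also have "\<dots> \<le> 42" using 3 by (simp add: mult_ac)
  finally have "(14 * s + 1) * (exp (- (s\<^sup>2)) * exp s) \<le> 42" .
  then have "(14 * s + 1) * (exp (- (s\<^sup>2)) * exp s) * exp (- s) \<le> 42 * exp (- s)" by (rule mult_right_mono) simp
  then show ?thesis by (simp add: mult.assoc exp_minus_inverse)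
qed

text \<open>The integration by parts is applied with \<open>a = |\<xi>|\<close>. Of the factor \<open>\<xi>^2\<close> in the symbol one power is
spent on the singular term \<open>1 / (t^2 |\<xi>|)\<close>; the other one is the \<open>|\<xi>|\<close> of the model kernel. The
remaining Gaussian in \<open>t |\<xi>|\<close> is dominated by the exponential.\<close>

lemma partial_ft_gauss_symbol_bound:
  assumes m: "line_symbol A m" and e: "e > 0"
  shows "cmod (partial_ft (gauss_symbol e R m) p v) \<le> 42 * pi * A * poisson_weight e R p v"
proof (cases "fst p \<in> {e..R} \<and> snd p \<noteq> 0")
  case False
  then show ?thesis by (auto simp: partial_ft_def gauss_symbol_def poisson_weight_def abs_weight_def)
next
  case True
  define t \<xi> where p: "t = fst p" "\<xi> = snd p"
  have t: "t > 0" "t \<in> {e..R}" and \<xi>: "\<xi> \<noteq> 0" using True e by (auto simp: p)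
  obtain g1 g2 where g: "\<And>\<eta>. ((\<lambda>\<eta>. m (\<xi>, \<eta>)) has_vector_derivative g1 \<eta>) (at \<eta>)"
     "\<And>\<eta>. (g1 has_vector_derivative g2 \<eta>) (at \<eta>)" "continuous_on UNIV g2"
     "\<And>\<eta>. cmod (m (\<xi>, \<eta>)) \<le> A" "\<And>\<eta>. cmod (g1 \<eta>) * (\<bar>\<xi>\<bar> + \<bar>\<eta>\<bar>) \<le> A"
     "\<And>\<eta>. cmod (g2 \<eta>) * (\<bar>\<xi>\<bar> + \<bar>\<eta>\<bar>)\<^sup>2 \<le> A"
    using m \<xi> unfolding line_symbol_def by metis
  have A: "A \<ge> 0" using g(4)[of 0] norm_ge_zero order_trans by blast
  define I where "I = (LINT \<eta>|lborel. m (\<xi>, \<eta>) * complex_of_real (exp (- (t\<^sup>2 * \<eta>\<^sup>2))) * wave (\<eta> * v))"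
  have I: "cmod I \<le> A * pi * (14 / t + 1 / (t\<^sup>2 * \<bar>\<xi>\<bar>)) * decay (2 * pi / t * v)"
    unfolding I_def using gauss_multiplier_ft_bound[OF g, of t] t \<xi> by simp
  define s where "s = t * \<bar>\<xi>\<bar>"
  have s: "s \<ge> 0" "s\<^sup>2 = t\<^sup>2 * \<xi>\<^sup>2" using t by (auto simp: s_def power_mult_distrib)
  have "partial_ft (gauss_symbol e R m) p v = (LINT \<eta>|lborel. complex_of_real (2 * t * \<xi>\<^sup>2 * exp (- (t\<^sup>2 * \<xi>\<^sup>2))) *
      (m (\<xi>, \<eta>) * complex_of_real (exp (- (t\<^sup>2 * \<eta>\<^sup>2))) * wave (\<eta> * v)))"
    unfolding partial_ft_def gauss_symbol_def using t by (simp add: p mult.assoc)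
  also have "\<dots> = complex_of_real (2 * t * \<xi>\<^sup>2 * exp (- (t\<^sup>2 * \<xi>\<^sup>2))) * I"
    unfolding I_def by (rule integral_mult_right_zero)
  finally have "cmod (partial_ft (gauss_symbol e R m) p v) = (2 * t * \<xi>\<^sup>2 * exp (- (s\<^sup>2))) * cmod I"
    using t by (simp add: norm_mult norm_power s)
  also have "\<dots> \<le> (2 * t * \<xi>\<^sup>2 * exp (- (s\<^sup>2))) * (A * pi * (14 / t + 1 / (t\<^sup>2 * \<bar>\<xi>\<bar>)) * decay (2 * pi / t * v))"
    using t by (intro mult_left_mono I) auto
  also have "\<dots> = (A * pi * \<bar>\<xi>\<bar> * poisson t v) * ((14 * s + 1) * exp (- (s\<^sup>2)))"
  proof -
    have "2 * t * x\<^sup>2 * (14 / t + 1 / (t\<^sup>2 * x)) = x * (2 / t) * (14 * (t * x) + 1)" if "x > 0" for x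
      using t that by (simp add: field_simps power2_eq_square)
    from this[of "\<bar>\<xi>\<bar>"] have "2 * t * \<xi>\<^sup>2 * (14 / t + 1 / (t\<^sup>2 * \<bar>\<xi>\<bar>)) = \<bar>\<xi>\<bar> * (2 / t) * (14 * s + 1)"
      using \<xi> by (simp add: s_def)
    then have "2 * t * \<xi>\<^sup>2 * (14 / t + 1 / (t\<^sup>2 * \<bar>\<xi>\<bar>)) * (exp (- (s\<^sup>2)) * A * pi * decay (2 * pi / t * v))
      = \<bar>\<xi>\<bar> * (2 / t) * (14 * s + 1) * (exp (- (s\<^sup>2)) * A * pi * decay (2 * pi / t * v))" by (rule arg_cong)
    then show ?thesis unfolding poisson_eq_decay[OF t(1)] by (simp only: mult_ac)
  qed
  also have "\<dots> \<le> (A * pi * \<bar>\<xi>\<bar> * poisson t v) * (42 * exp (- s))"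
    using A t by (intro mult_left_mono gauss_le_exp s) (auto simp: poisson_nonneg)
  also have "\<dots> = 42 * pi * A * poisson_weight e R p v"
    using t by (simp add: poisson_weight_def abs_weight_def s_def p)
  finally show ?thesis .
qed

lemma integrable_gauss_symbol:
  assumes [measurable]: "m \<in> borel_measurable borel" and B: "\<And>s. cmod (m s) \<le> B" and e: "e > 0"
  shows "integrable lborel (gauss_symbol e R m)"
proof -
  obtain D where D: "D > 0" "\<And>x. (1 + \<bar>x\<bar> + x\<^sup>2) * exp (- (e\<^sup>2 * x\<^sup>2)) \<le> D * decay x" using gauss_le_decay[OF e] by metis
  have B0: "B \<ge> 0" using B[of "(0, 0)"] norm_ge_zero order_trans by blast
  show ?thesis
  proof (rule integrable_window_decay[where D = "2 * \<bar>R\<bar> * B * (D * D)"])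
    show "gauss_symbol e R m \<in> borel_measurable borel" unfolding gauss_symbol_def[abs_def] by measurable
    fix t \<xi> \<eta> :: real
    show "cmod (gauss_symbol e R m ((t, \<xi>), \<eta>)) \<le> 2 * \<bar>R\<bar> * B * (D * D) * ((indicator {e..R} t * decay \<xi>) * decay \<eta>)"
    proof (cases "t \<in> {e..R}")
      case True
      then have t: "t > 0" "t \<le> \<bar>R\<bar>" using e by auto
      have le: "exp (- (t\<^sup>2 * x\<^sup>2)) \<le> exp (- (e\<^sup>2 * x\<^sup>2))" for x
        using True e by (auto intro!: mult_right_mono power_mono)
      have "\<xi>\<^sup>2 * exp (- (t\<^sup>2 * \<xi>\<^sup>2)) \<le> (1 + \<bar>\<xi>\<bar> + \<xi>\<^sup>2) * exp (- (e\<^sup>2 * \<xi>\<^sup>2))" by (intro mult_mono le) auto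
      also note D(2)
      finally have 1: "\<xi>\<^sup>2 * exp (- (t\<^sup>2 * \<xi>\<^sup>2)) \<le> D * decay \<xi>" .
      have "1 * exp (- (t\<^sup>2 * \<eta>\<^sup>2)) \<le> (1 + \<bar>\<eta>\<bar> + \<eta>\<^sup>2) * exp (- (e\<^sup>2 * \<eta>\<^sup>2))" by (intro mult_mono le) auto
      also note D(2)
      finally have 2: "exp (- (t\<^sup>2 * \<eta>\<^sup>2)) \<le> D * decay \<eta>" by simp
      have "cmod (gauss_symbol e R m ((t, \<xi>), \<eta>)) = (2 * t) * (\<xi>\<^sup>2 * exp (- (t\<^sup>2 * \<xi>\<^sup>2))) * (cmod (m (\<xi>, \<eta>)) * exp (- (t\<^sup>2 * \<eta>\<^sup>2)))"
        using True t by (simp add: gauss_symbol_def norm_mult norm_power)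
      also have "\<dots> \<le> (2 * \<bar>R\<bar>) * (D * decay \<xi>) * (B * (D * decay \<eta>))"
        by (intro mult_mono 1 2 B) (use D B0 t in auto)
      finally show ?thesis using True by (simp add: mult_ac)
    qed (simp add: gauss_symbol_def)
  qed
qed

text \<open>The two parts add up to \<open>m(\<xi>, \<eta>)\<close> times \<open>- d/dt e^{-t^2(\<xi>^2 + \<eta>^2)}\<close>.\<close>

lemma gauss_symbol_telescope:
  assumes "e \<le> R"
  shows "(LINT t|lborel. gauss_symbol e R m ((t, \<xi>), \<eta>)) + (LINT t|lborel. gauss_symbol e R (flip m) ((t, \<eta>), \<xi>))
    = m (\<xi>, \<eta>) * complex_of_real (exp (- (e\<^sup>2 * (\<xi>\<^sup>2 + \<eta>\<^sup>2))) - exp (- (R\<^sup>2 * (\<xi>\<^sup>2 + \<eta>\<^sup>2))))"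
proof -
  let ?s = "\<xi>\<^sup>2 + \<eta>\<^sup>2"
  have i: "integrable lborel (\<lambda>t. indicator {e..R} t * (2 * t * a * exp (- (t\<^sup>2 * ?s))))" for a :: real
    by (intro integrable_window continuous_intros)
  have eq: "gauss_symbol e R m' ((t, x), y) = m' (x, y) * complex_of_real (indicator {e..R} t * (2 * t * x\<^sup>2 * exp (- (t\<^sup>2 * (x\<^sup>2 + y\<^sup>2)))))" for m' t x y
  proof -
    have "exp (- (t\<^sup>2 * (x\<^sup>2 + y\<^sup>2))) = exp (- (t\<^sup>2 * x\<^sup>2)) * exp (- (t\<^sup>2 * y\<^sup>2))"
      by (simp add: distrib_left flip: exp_add)
    then show ?thesis by (simp add: gauss_symbol_def)
  qed
  have "(LINT t|lborel. indicator {e..R} t * (2 * t * \<xi>\<^sup>2 * exp (- (t\<^sup>2 * ?s)))) + (LINT t|lborel. indicator {e..R} t * (2 * t * \<eta>\<^sup>2 * exp (- (t\<^sup>2 * ?s))))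
    = (LINT t|lborel. indicator {e..R} t * (2 * t * \<xi>\<^sup>2 * exp (- (t\<^sup>2 * ?s))) + indicator {e..R} t * (2 * t * \<eta>\<^sup>2 * exp (- (t\<^sup>2 * ?s))))"
    by (rule Bochner_Integration.integral_add[OF i i, symmetric])
  also have "\<dots> = (LINT t|lborel. indicator {e..R} t * (2 * t * ?s * exp (- (t\<^sup>2 * ?s))))"
    by (intro Bochner_Integration.integral_cong refl) (simp add: algebra_simps)
  also have "\<dots> = - exp (- (R\<^sup>2 * ?s)) - (- exp (- (e\<^sup>2 * ?s)))"
    by (rule window_FTC[OF assms]) (auto intro!: derivative_eq_intros continuous_intros simp: algebra_simps)
  finally have *: "(LINT t|lborel. indicator {e..R} t * (2 * t * \<xi>\<^sup>2 * exp (- (t\<^sup>2 * ?s)))) + (LINT t|lborel. indicator {e..R} t * (2 * t * \<eta>\<^sup>2 * exp (- (t\<^sup>2 * ?s))))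
    = exp (- (e\<^sup>2 * ?s)) - exp (- (R\<^sup>2 * ?s))" by simp
  have f: "flip m (\<eta>, \<xi>) = m (\<xi>, \<eta>)" by (simp add: flip_def)
  show ?thesis
    unfolding eq f add.commute[of "\<eta>\<^sup>2" "\<xi>\<^sup>2"] integral_mult_right_zero Bochner_Integration.integral_complex_of_real distrib_left[symmetric]
      of_real_add[symmetric] * ..
qed

text \<open>Each of the two mirrored forms contributes \<open>4 * 42 \<pi> A\<close>.\<close>

lemma truncated_form_bound:
  assumes adm: "admissible F1" "admissible F2" "admissible F3" "admissible F4" and e: "0 < e" "e \<le> R"
    and m: "m \<in> borel_measurable borel" "\<And>s. cmod (m s) \<le> B" "line_symbol A m" "line_symbol A (flip m)" and A: "A \<ge> 0"
  shows "cmod (LINT s|lborel. diag_ft F1 F2 F3 F4 s * (m s * complex_of_real (exp (- (e\<^sup>2 * ((fst s)\<^sup>2 + (snd s)\<^sup>2))) - exp (- (R\<^sup>2 * ((fst s)\<^sup>2 + (snd s)\<^sup>2))))))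
    \<le> 336 * pi * A * (Lp_norm 4 F1 * Lp_norm 4 F2 * Lp_norm 4 F3 * Lp_norm 4 F4)"
proof -
  let ?N = "Lp_norm 4 F1 * Lp_norm 4 F2 * Lp_norm 4 F3 * Lp_norm 4 F4"
  note adm' = admissible_flip[OF adm(1)] admissible_flip[OF adm(4)] admissible_flip[OF adm(3)] admissible_flip[OF adm(2)]
  have fm: "flip m \<in> borel_measurable borel" "\<And>s. cmod (flip m s) \<le> B"
    using m(1,2) by (auto simp: flip_def[abs_def])
  have i: "integrable lborel (gauss_symbol e R m)" "integrable lborel (gauss_symbol e R (flip m))"
    by (rule integrable_gauss_symbol[OF m(1,2) e(1)], rule integrable_gauss_symbol[OF fm e(1)])
  have eq: "(LINT s|lborel. diag_ft F1 F2 F3 F4 s * (m s * complex_of_real (exp (- (e\<^sup>2 * ((fst s)\<^sup>2 + (snd s)\<^sup>2))) - exp (- (R\<^sup>2 * ((fst s)\<^sup>2 + (snd s)\<^sup>2))))))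
    = slice_form F1 F2 F3 F4 (partial_ft (gauss_symbol e R m)) + slice_form (flip F1) (flip F4) (flip F3) (flip F2) (partial_ft (gauss_symbol e R (flip m)))"
    unfolding symmetric_form_representation[OF adm i, symmetric] gauss_symbol_telescope[OF e(2)] prod.collapse ..
  have D: "0 \<le> 42 * pi * A" using A by simp
  have 1: "cmod (slice_form F1 F2 F3 F4 (partial_ft (gauss_symbol e R m))) \<le> 4 * (42 * pi * A) * ?N"
    by (rule slice_form_bound[OF adm e partial_ft_gauss_symbol_bound[OF m(3) e(1)] D])
  have 2: "cmod (slice_form (flip F1) (flip F4) (flip F3) (flip F2) (partial_ft (gauss_symbol e R (flip m)))) \<le> 4 * (42 * pi * A) * ?N"
    using slice_form_bound[OF adm' e partial_ft_gauss_symbol_bound[OF m(4) e(1)] D]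
    by (simp add: Lp_norm_flip adm mult_ac)
  have "4 * (42 * pi * A) * ?N + 4 * (42 * pi * A) * ?N = 336 * pi * A * ?N" by simp
  then show ?thesis unfolding eq using add_mono[OF 1 2]
    by (intro order_trans[OF norm_triangle_ineq]) (simp only:)
qed

text \<open>The truncated multipliers converge to \<open>m\<close> off the origin and are dominated by \<open>|m|\<close>. If
\<open>\<Phi> m\<close> is not integrable, the Bochner integral defining the form is \<open>0\<close> by convention; otherwise
dominated convergence applies.\<close>

lemma entangled_form_bound:
  assumes adm: "admissible F1" "admissible F2" "admissible F3" "admissible F4"
    and m: "m \<in> borel_measurable borel" "\<And>s. cmod (m s) \<le> B" "line_symbol A m" "line_symbol A (flip m)" and A: "A \<ge> 0"
  shows "cmod (entangled_form m F1 F2 F3 F4) \<le> 336 * pi * A * (Lp_norm 4 F1 * Lp_norm 4 F2 * Lp_norm 4 F3 * Lp_norm 4 F4)"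
proof -
  let ?f = "\<lambda>s. diag_ft F1 F2 F3 F4 s * m s"
  have form: "entangled_form m F1 F2 F3 F4 = (LINT s|lborel. ?f s)"
    by (simp add: entangled_form_def diag_ft_def case_prod_beta')
  show ?thesis
  proof (cases "integrable lborel ?f")
    case False
    then show ?thesis using A by (simp add: form not_integrable_integral_eq Lp_norm_nonneg)
  next
    case True
    define c where "c = (\<lambda>(n::nat) s::real \<times> real. exp (- ((1 / (real n + 1))\<^sup>2 * ((fst s)\<^sup>2 + (snd s)\<^sup>2))) - exp (- ((real n + 1)\<^sup>2 * ((fst s)\<^sup>2 + (snd s)\<^sup>2))))"
    have [measurable]: "diag_ft F1 F2 F3 F4 \<in> borel_measurable borel" "m \<in> borel_measurable borel"
      using diag_ft_measurable[OF adm] m(1) by auto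
    have fm: "?f \<in> borel_measurable lborel" using True by (rule borel_measurable_integrable)
    have "(\<lambda>n. LINT s|lborel. ?f s * complex_of_real (c n s)) \<longlonglongrightarrow> (LINT s|lborel. ?f s)"
    proof (rule integral_dominated_convergence)
      show "integrable lborel (\<lambda>s. norm (?f s))" using True by simp
      show "(\<lambda>s. ?f s * complex_of_real (c n s)) \<in> borel_measurable lborel" for n
        unfolding c_def by measurable
      show "AE s in lborel. norm (?f s * complex_of_real (c n s)) \<le> norm (?f s)" for n
      proof (rule AE_I2)
        fix s :: "real \<times> real"
        let ?r = "(fst s)\<^sup>2 + (snd s)\<^sup>2"
        have "0 \<le> exp (- ((1 / (real n + 1))\<^sup>2 * ?r))" "exp (- ((1 / (real n + 1))\<^sup>2 * ?r)) \<le> 1"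
          "0 \<le> exp (- ((real n + 1)\<^sup>2 * ?r))" "exp (- ((real n + 1)\<^sup>2 * ?r)) \<le> 1" by auto
        then have "\<bar>c n s\<bar> \<le> 1" unfolding c_def by linarith
        then have "norm (?f s) * \<bar>c n s\<bar> \<le> norm (?f s) * 1" by (intro mult_left_mono) auto
        then show "norm (?f s * complex_of_real (c n s)) \<le> norm (?f s)" by (simp add: norm_mult)
      qed
      have "(\<lambda>n. c n s) \<longlonglongrightarrow> 1" if "s \<noteq> (0, 0)" for s
      proof -
        define r where "r = (fst s)\<^sup>2 + (snd s)\<^sup>2"
        have "r > 0" using that by (cases s) (auto simp: r_def sum_power2_gt_zero_iff)
        then show ?thesis unfolding c_def r_def[symmetric] by real_asymp
      qed
      then have conv: "(\<lambda>n. ?f s * complex_of_real (c n s)) \<longlonglongrightarrow> ?f s * complex_of_real 1" if "s \<noteq> (0, 0)" for s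
        using that by (intro tendsto_mult tendsto_const tendsto_of_real)
      show "AE s in lborel. (\<lambda>n. ?f s * complex_of_real (c n s)) \<longlonglongrightarrow> ?f s"
        using AE_lborel_singleton[of "(0, 0)"]
      proof eventually_elim
        case (elim s)
        then show ?case using conv[OF elim] by (simp only: of_real_1 mult_1_right)
      qed
    qed (rule fm)
    then have lim: "(\<lambda>n. cmod (LINT s|lborel. ?f s * complex_of_real (c n s))) \<longlonglongrightarrow> cmod (LINT s|lborel. ?f s)"
      by (rule tendsto_norm)
    have bound: "cmod (LINT s|lborel. ?f s * complex_of_real (c n s)) \<le> 336 * pi * A * (Lp_norm 4 F1 * Lp_norm 4 F2 * Lp_norm 4 F3 * Lp_norm 4 F4)" for n
    proof -
      have "1 / (real n + 1) \<le> 1" by simp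
      then have "1 / (real n + 1) \<le> real n + 1" by linarith
      then show ?thesis
        using truncated_form_bound[OF adm _ _ m A, of "1 / (real n + 1)" "real n + 1"]
        by (simp add: c_def mult.assoc)
    qed
    show ?thesis unfolding form by (rule LIMSEQ_le_const2[OF lim]) (use bound in auto)
  qed
qed

section \<open>Schwartz functions and smooth symbols\<close>

text \<open>\<open>(1 + x^2) (1 + y^2) \<le> (1 + n^2)^2 \<le> 2 + 2 n^4\<close> for \<open>n = |(x, y)|\<close>, so the seminorms with
\<open>k = 0\<close> and \<open>k = 4\<close> suffice.\<close>

lemma schwartz_admissible:
  assumes "schwartz F"
  shows "admissible F"
proof -
  have "iterated_partial [] F differentiable_on UNIV"
    using assms unfolding schwartz_def smooth_on_def by (metis empty_set empty_subsetI)
  then have "continuous_on UNIV F" by (simp add: iterated_partial_def differentiable_imp_continuous_on)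
  then have meas: "F \<in> borel_measurable borel" by (rule borel_measurable_continuous_onI)
  have "bounded (range (\<lambda>x. norm x ^ k *\<^sub>R F x))" for k
  proof -
    have "bounded (range (\<lambda>x. norm x ^ k *\<^sub>R iterated_partial [] F x))"
      using assms unfolding schwartz_def by (metis empty_set empty_subsetI)
    then show ?thesis by (simp add: iterated_partial_def)
  qed
  then have "\<exists>B. \<forall>x. norm (norm x ^ k *\<^sub>R F x) \<le> B" for k by (auto simp: bounded_iff)
  then obtain B where B: "\<And>k x. norm (norm x ^ k *\<^sub>R F x) \<le> B k" by metis
  have "cmod (F (x, y)) \<le> (2 * B 0 + 2 * B 4) * (decay x * decay y)" for x y
  proof -
    define n where "n = norm (x, y)"
    have n: "n\<^sup>2 = x\<^sup>2 + y\<^sup>2" by (simp add: n_def norm_Pair)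
    have "(1 + x\<^sup>2) * (1 + y\<^sup>2) \<le> (1 + n\<^sup>2) * (1 + n\<^sup>2)" by (intro mult_mono) (auto simp: n)
    also have "\<dots> \<le> 2 + 2 * n ^ 4"
    proof -
      have "0 \<le> (n\<^sup>2 - 1)\<^sup>2" by simp
      then show ?thesis by (simp add: power2_eq_square power4_eq_xxxx algebra_simps)
    qed
    finally have "cmod (F (x, y)) * ((1 + x\<^sup>2) * (1 + y\<^sup>2)) \<le> cmod (F (x, y)) * (2 + 2 * n ^ 4)"
      by (rule mult_left_mono) simp
    also have "\<dots> \<le> 2 * B 0 + 2 * B 4"
      using B[of "(x, y)" 0] B[of "(x, y)" 4] by (simp add: n_def algebra_simps)
    finally have "cmod (F (x, y)) \<le> (2 * B 0 + 2 * B 4) / ((1 + x\<^sup>2) * (1 + y\<^sup>2))"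
      by (subst pos_le_divide_eq) (auto intro!: mult_pos_pos add_pos_nonneg)
    then show ?thesis by (simp add: decay_def divide_inverse)
  qed
  with meas show ?thesis unfolding admissible_def by blast
qed

lemma iterated_partial_along_line:
  fixes f :: "'a::euclidean_space \<Rightarrow> complex"
  assumes f: "smooth_on S f" and S: "open S" and b: "b \<in> Basis" and bs: "set bs \<subseteq> Basis"
    and w: "w + s *\<^sub>R b \<in> S"
  shows "((\<lambda>s. iterated_partial bs f (w + s *\<^sub>R b)) has_vector_derivative iterated_partial (b # bs) f (w + s *\<^sub>R b)) (at s)"
proof -
  let ?h = "iterated_partial bs f"
  have "?h differentiable_on S" using f bs by (auto simp: smooth_on_def)
  then have "?h differentiable (at (w + s *\<^sub>R b))"
    using S w by (metis at_within_open differentiable_on_def)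
  then obtain D where D: "(?h has_derivative D) (at (w + s *\<^sub>R b))" by (auto simp: differentiable_def)
  have line: "((\<lambda>t. ?h (z + t *\<^sub>R b)) has_vector_derivative D b) (at r)" if "z + r *\<^sub>R b = w + s *\<^sub>R b" for z r
  proof -
    have "((\<lambda>t. z + t *\<^sub>R b) has_derivative (\<lambda>t. t *\<^sub>R b)) (at r)"
      by (auto intro!: derivative_eq_intros)
    then have "((\<lambda>t. ?h (z + t *\<^sub>R b)) has_derivative (\<lambda>t. D (t *\<^sub>R b))) (at r)"
      using has_derivative_compose[of "\<lambda>t. z + t *\<^sub>R b" _ r UNIV ?h D] D that by simp
    moreover have "D (t *\<^sub>R b) = t *\<^sub>R D b" for t
      using has_derivative_linear[OF D] by (simp add: linear_cmul)
    ultimately show ?thesis by (simp add: has_vector_derivative_def)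
  qed
  have "iterated_partial (b # bs) f (w + s *\<^sub>R b) = D b"
    using vector_derivative_at[OF line[of "w + s *\<^sub>R b" 0]] by (simp add: iterated_partial_def partial_deriv_def)
  then show ?thesis using line[of w s] by simp
qed

text \<open>Serves both \<open>m\<close> (with \<open>b = (0, 1)\<close>) and its flip (with \<open>b = (1, 0)\<close>); \<open>w \<xi>\<close> is the point where the
line meets the other axis.\<close>

lemma line_symbolI:
  fixes m :: "real \<times> real \<Rightarrow> complex"
  assumes m: "smooth_on (UNIV - {(0, 0)}) m" and b: "b \<in> Basis" and w: "\<And>\<xi> \<eta>. \<xi> \<noteq> 0 \<Longrightarrow> w \<xi> + \<eta> *\<^sub>R b \<noteq> (0, 0)"
    and eq: "\<And>\<xi> \<eta>. m' (\<xi>, \<eta>) = m (w \<xi> + \<eta> *\<^sub>R b)"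
    and 0: "\<And>\<xi> \<eta>. \<xi> \<noteq> 0 \<Longrightarrow> cmod (m (w \<xi> + \<eta> *\<^sub>R b)) \<le> A"
    and 1: "\<And>\<xi> \<eta>. \<xi> \<noteq> 0 \<Longrightarrow> cmod (iterated_partial [b] m (w \<xi> + \<eta> *\<^sub>R b)) \<le> A * (\<bar>\<xi>\<bar> + \<bar>\<eta>\<bar>) powi (- 1)"
    and 2: "\<And>\<xi> \<eta>. \<xi> \<noteq> 0 \<Longrightarrow> cmod (iterated_partial [b, b] m (w \<xi> + \<eta> *\<^sub>R b)) \<le> A * (\<bar>\<xi>\<bar> + \<bar>\<eta>\<bar>) powi (- 2)"
  shows "line_symbol A m'"
  unfolding line_symbol_def
proof (intro allI impI)
  fix \<xi> :: real assume \<xi>: "\<xi> \<noteq> 0"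
  let ?d = "\<lambda>bs \<eta>. iterated_partial bs m (w \<xi> + \<eta> *\<^sub>R b)"
  have S: "open (UNIV - {(0 :: real, 0 :: real)})" by (simp add: open_delete)
  have D: "(?d bs has_vector_derivative ?d (b # bs) \<eta>) (at \<eta>)" if "set bs \<subseteq> Basis" for bs \<eta>
    by (rule iterated_partial_along_line[OF m S b that]) (use w[OF \<xi>] in auto)
  have pos: "\<bar>\<xi>\<bar> + \<bar>\<eta>\<bar> > 0" for \<eta> using \<xi> by (simp add: add_pos_nonneg)
  show "\<exists>g1 g2. (\<forall>\<eta>. ((\<lambda>\<eta>. m' (\<xi>, \<eta>)) has_vector_derivative g1 \<eta>) (at \<eta>)) \<and>
     (\<forall>\<eta>. (g1 has_vector_derivative g2 \<eta>) (at \<eta>)) \<and> continuous_on UNIV g2 \<and>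
     (\<forall>\<eta>. cmod (m' (\<xi>, \<eta>)) \<le> A) \<and> (\<forall>\<eta>. cmod (g1 \<eta>) * (\<bar>\<xi>\<bar> + \<bar>\<eta>\<bar>) \<le> A) \<and>
     (\<forall>\<eta>. cmod (g2 \<eta>) * (\<bar>\<xi>\<bar> + \<bar>\<eta>\<bar>)\<^sup>2 \<le> A)"
  proof (rule exI[of _ "?d [b]"], rule exI[of _ "?d [b, b]"], intro conjI allI)
    show "((\<lambda>\<eta>. m' (\<xi>, \<eta>)) has_vector_derivative ?d [b] \<eta>) (at \<eta>)" for \<eta>
      using D[of "[]"] by (simp add: eq iterated_partial_def)
    show "(?d [b] has_vector_derivative ?d [b, b] \<eta>) (at \<eta>)" for \<eta>
      using D[of "[b]"] b by simp
    show "continuous_on UNIV (?d [b, b])"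
      using D[of "[b, b]"] b by (intro continuous_at_imp_continuous_on ballI has_vector_derivative_continuous) auto
    show "cmod (m' (\<xi>, \<eta>)) \<le> A" for \<eta> using 0[OF \<xi>] by (simp add: eq)
    show "cmod (?d [b] \<eta>) * (\<bar>\<xi>\<bar> + \<bar>\<eta>\<bar>) \<le> A" for \<eta>
      using 1[OF \<xi>, of \<eta>] pos[of \<eta>] by (simp add: power_int_minus divide_inverse[symmetric] pos_le_divide_eq)
    show "cmod (?d [b, b] \<eta>) * (\<bar>\<xi>\<bar> + \<bar>\<eta>\<bar>)\<^sup>2 \<le> A" for \<eta>
      using 2[OF \<xi>, of \<eta>] pos[of \<eta>] by (simp add: power_int_minus divide_inverse[symmetric] pos_le_divide_eq)
  qed
qed

theorem theorem1:
  "\<exists>N::nat. N > 0 \<and>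
    (\<forall>A::real. A > 0 \<longrightarrow>
      (\<exists>C::real. C > 0 \<and>
        (\<forall>m :: real \<times> real \<Rightarrow> complex.
          bounded (range m) \<longrightarrow>
          smooth_on (UNIV - {(0, 0)}) m \<longrightarrow>
          (\<forall>a b \<xi> \<eta>. a + b \<le> N \<longrightarrow> (\<xi>, \<eta>) \<noteq> (0, 0) \<longrightarrow>
             norm (multi_partial a b m (\<xi>, \<eta>))
               \<le> A * (\<bar>\<xi>\<bar> + \<bar>\<eta>\<bar>) powi (- int (a + b))) \<longrightarrow>
          (\<forall>F1 F2 F3 F4 :: real \<times> real \<Rightarrow> complex.
             schwartz F1 \<longrightarrow> schwartz F2 \<longrightarrow> schwartz F3 \<longrightarrow> schwartz F4 \<longrightarrow>
             norm (entangled_form m F1 F2 F3 F4)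
               \<le> C * Lp_norm 4 F1 * Lp_norm 4 F2 * Lp_norm 4 F3 * Lp_norm 4 F4))))"
proof (rule exI[of _ "2 :: nat"], intro conjI allI impI)
  fix A :: real assume A: "A > 0"
  show "\<exists>C::real. C > 0 \<and>
        (\<forall>m :: real \<times> real \<Rightarrow> complex.
          bounded (range m) \<longrightarrow>
          smooth_on (UNIV - {(0, 0)}) m \<longrightarrow>
          (\<forall>a b \<xi> \<eta>. a + b \<le> 2 \<longrightarrow> (\<xi>, \<eta>) \<noteq> (0, 0) \<longrightarrow>
             norm (multi_partial a b m (\<xi>, \<eta>))
               \<le> A * (\<bar>\<xi>\<bar> + \<bar>\<eta>\<bar>) powi (- int (a + b))) \<longrightarrow>
          (\<forall>F1 F2 F3 F4 :: real \<times> real \<Rightarrow> complex.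
             schwartz F1 \<longrightarrow> schwartz F2 \<longrightarrow> schwartz F3 \<longrightarrow> schwartz F4 \<longrightarrow>
             norm (entangled_form m F1 F2 F3 F4)
               \<le> C * Lp_norm 4 F1 * Lp_norm 4 F2 * Lp_norm 4 F3 * Lp_norm 4 F4))"
  proof (rule exI[of _ "336 * pi * A"], intro conjI allI impI)
    show "336 * pi * A > 0" using A by simp
    fix m :: "real \<times> real \<Rightarrow> complex" and F1 F2 F3 F4 :: "real \<times> real \<Rightarrow> complex"
    assume bd: "bounded (range m)" and sm: "smooth_on (UNIV - {(0, 0)}) m"
      and est: "\<forall>a b \<xi> \<eta>. a + b \<le> 2 \<longrightarrow> (\<xi>, \<eta>) \<noteq> (0, 0) \<longrightarrow>
             norm (multi_partial a b m (\<xi>, \<eta>)) \<le> A * (\<bar>\<xi>\<bar> + \<bar>\<eta>\<bar>) powi (- int (a + b))"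
      and F: "schwartz F1" "schwartz F2" "schwartz F3" "schwartz F4"
    have "iterated_partial [] m differentiable_on UNIV - {(0, 0)}"
      using sm unfolding smooth_on_def by (metis empty_set empty_subsetI)
    then have "continuous_on (- {(0, 0)}) m"
      by (simp add: iterated_partial_def differentiable_imp_continuous_on Compl_eq_Diff_UNIV)
    then have meas: "m \<in> borel_measurable borel"
      by (rule borel_measurable_continuous_countable_exceptions[rotated]) simp
    obtain B where B: "\<And>s. cmod (m s) \<le> B" using bd by (auto simp: bounded_iff)
    have est0: "cmod (m p) \<le> A" if "p \<noteq> (0, 0)" for p
      using est[rule_format, of 0 0 "fst p" "snd p"] that by (simp add: multi_partial_def iterated_partial_def)
    have bas: "(1, 0) \<in> (Basis :: (real \<times> real) set)" "(0, 1) \<in> (Basis :: (real \<times> real) set)"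
      by (auto simp: Basis_prod_def)
    have L1: "line_symbol A m"
    proof (rule line_symbolI[OF sm bas(2), where w = "\<lambda>\<xi>. (\<xi>, 0)"])
      fix \<xi> \<eta> :: real assume \<xi>: "\<xi> \<noteq> 0"
      show "cmod (m ((\<xi>, 0) + \<eta> *\<^sub>R (0, 1))) \<le> A" using \<xi> by (intro est0) simp
      show "cmod (iterated_partial [(0, 1)] m ((\<xi>, 0) + \<eta> *\<^sub>R (0, 1))) \<le> A * (\<bar>\<xi>\<bar> + \<bar>\<eta>\<bar>) powi (- 1)"
        using est[rule_format, of 0 1 \<xi> \<eta>] \<xi> by (simp add: multi_partial_def)
      show "cmod (iterated_partial [(0, 1), (0, 1)] m ((\<xi>, 0) + \<eta> *\<^sub>R (0, 1))) \<le> A * (\<bar>\<xi>\<bar> + \<bar>\<eta>\<bar>) powi (- 2)"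
        using est[rule_format, of 0 2 \<xi> \<eta>] \<xi> by (simp add: multi_partial_def numeral_2_eq_2)
    qed auto
    have L2: "line_symbol A (flip m)"
    proof (rule line_symbolI[OF sm bas(1), where w = "\<lambda>\<xi>. (0, \<xi>)"])
      fix \<xi> \<eta> :: real assume \<xi>: "\<xi> \<noteq> 0"
      show "cmod (m ((0, \<xi>) + \<eta> *\<^sub>R (1, 0))) \<le> A" using \<xi> by (intro est0) simp
      show "cmod (iterated_partial [(1, 0)] m ((0, \<xi>) + \<eta> *\<^sub>R (1, 0))) \<le> A * (\<bar>\<xi>\<bar> + \<bar>\<eta>\<bar>) powi (- 1)"
        using est[rule_format, of 1 0 \<eta> \<xi>] \<xi> by (simp add: multi_partial_def add.commute)
      show "cmod (iterated_partial [(1, 0), (1, 0)] m ((0, \<xi>) + \<eta> *\<^sub>R (1, 0))) \<le> A * (\<bar>\<xi>\<bar> + \<bar>\<eta>\<bar>) powi (- 2)"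
        using est[rule_format, of 2 0 \<eta> \<xi>] \<xi> by (simp add: multi_partial_def numeral_2_eq_2 add.commute)
    qed (auto simp: flip_def)
    show "norm (entangled_form m F1 F2 F3 F4) \<le> 336 * pi * A * Lp_norm 4 F1 * Lp_norm 4 F2 * Lp_norm 4 F3 * Lp_norm 4 F4"
      using entangled_form_bound[OF F[THEN schwartz_admissible] meas B L1 L2] A by (simp add: mult.assoc)
  qed
qed simp

end
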